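(* Let $L\in\mathbb{R}^{n\times n}$ be the Laplacian matrix of a connected, acyclic, undirected graph on $n$ nodes with positive edge weights, with eigenvalues $0=\lambda_1<\lambda_2\le\dots\le\lambda_n$. Let $m,d,k,b,\tau,\gamma>0$ and put $M=mI_n$, $D=dI_n$, $K=kI_n$, $B_1=bI_n$, $\mathcal T=\tau I_n$, $L_{\rm c}=\gamma L$. Consider the linear system $G$ with state $(\theta,\omega,p)\in\mathbb{R}^n\times\mathbb{R}^n\times\mathbb{R}^n$, input $\eta\in\mathbb{R}^n$ and output $y\in\mathbb{R}^n$: $$\dot\theta=\omega,\qquad M\dot\omega=-L\theta-D\omega+p+B_1\eta,\qquad \mathcal TK\dot p=-\omega-L_{\rm c}Kp,\qquad y=K^{1/2}p .$$ Then $$\|G\|_{\mathcal H_2}^2=\frac{b^2}{2\tau}\,\frac1d\sum_{i=1}^n\frac{1}{z_2\lambda_i^2+z_1\lambda_i+1},\qquad z_2=\frac{mk\gamma^2}{\tau},\qquad z_1=\frac{m\gamma}{d\tau}+kd\gamma+k\tau .$$ Moreover, with all other parameters held fixed: (i) (Overdamped limit) $\displaystyle\lim_{m\to0}\|G\|_{\mathcal H_2}^2=\frac{b^2}{2\tau}\,\frac1d\sum_{i=1}^n\frac{1}{1+(k\tau+kd\gamma)\lambda_i}$; (ii) (High averaging gain) $\displaystyle\lim_{\gamma\to\infty}\|G\|_{\mathcal H_2}^2=\frac{b^2}{2\tau}\,\frac1d$.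
   Context: $\mathcal H_2$ norm: for an input-output stable linear system $\dot x=Ax+B\eta$, $y=Cx$, $\|G\|_{\mathcal H_2}^2=\lim_{t\to\infty}\mathbb E[y(t)^\top y(t)]$ when $\eta$ is white noise with $\mathbb E[\eta(t)\eta(\tau)^\top]=\delta(t-\tau)I$; equivalently $\|G\|_{\mathcal H_2}^2=\int_0^\infty \mathrm{Tr}\big(B^\top e^{A^\top t}C^\top C e^{At}B\big)\,dt$. When $A$ is Hurwitz this equals $\mathrm{Tr}(B^\top XB)$ with $X$ the observability Gramian, $XA+A^\top X+C^\top C=0$. Here the state matrix is not Hurwitz (uniform translations of $\theta$ give a zero eigenvalue), and the $\mathcal H_2$ norm is understood via the impulse response from $\eta$ to $y$, i.e. by the integral formula. Interpretation: the system is the linearized swing dynamics of a power network ($\theta$ phase angles, $\omega$ frequency deviations) in closed loop with a distributed-averaging secondary controller; $\|y\|_2^2=p^\top Kp$. *)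

theory Defs
  imports "HOL-Analysis.Analysis"
begin

section \<open>Weighted graphs on the node set given by a finite type\<close>

definition simple_graph :: "'n set set \<Rightarrow> bool" where
  "simple_graph E \<longleftrightarrow> (\<forall>e\<in>E. card e = 2)"

definition graph_connected :: "'n set set \<Rightarrow> bool" where
  "graph_connected E \<longleftrightarrow> (\<forall>u v. (u, v) \<in> {(i, j). {i, j} \<in> E}\<^sup>*)"

definition graph_cycle :: "'n set set \<Rightarrow> 'n list \<Rightarrow> bool" where
  "graph_cycle E vs \<longleftrightarrow> 3 \<le> length vs \<and> distinct vs \<and>
     (\<forall>i<length vs. {vs ! i, vs ! (Suc i mod length vs)} \<in> E)"

definition graph_acyclic :: "'n set set \<Rightarrow> bool" where
  "graph_acyclic E \<longleftrightarrow> (\<nexists>vs. graph_cycle E vs)"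

definition laplacian :: "'n set set \<Rightarrow> ('n set \<Rightarrow> real) \<Rightarrow> real^'n^'n" where
  "laplacian E w = (\<chi> i j.
     if i = j then (\<Sum>e\<in>{e\<in>E. i \<in> e}. w e)
     else if {i, j} \<in> E then - w {i, j} else 0)"

section \<open>Matrices\<close>

text \<open>\<open>lam 1, \<dots>, lam n\<close> are the eigenvalues of \<open>A\<close>, repeated by algebraic multiplicity, in
  nondecreasing order; values of \<open>lam\<close> outside \<open>{1..n}\<close> are irrelevant. Recall that
  \<open>mat x\<close> is \<open>x\<close> times the identity matrix.\<close>

definition ordered_eigenvalues :: "real^'n^'n \<Rightarrow> (nat \<Rightarrow> real) \<Rightarrow> bool" where
  "ordered_eigenvalues A lam \<longleftrightarrow>
     (\<forall>x. det (mat x - A) = (\<Prod>i = 1..CARD('n). x - lam i)) \<and>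
     mono_on {1..CARD('n)} lam"

text \<open>The class operations \<open>(*)\<close>, \<open>(^)\<close> and \<open>exp\<close> are not the matrix operations on
  \<open>real^'n^'n\<close>.\<close>

definition matpow :: "real^'n^'n \<Rightarrow> nat \<Rightarrow> real^'n^'n" where
  "matpow A k = (((**) A) ^^ k) (mat 1)"

definition matexp :: "real^'n^'n \<Rightarrow> real^'n^'n" where
  "matexp A = (\<Sum>k. (1 / fact k) *\<^sub>R matpow A k)"

text \<open>The unique symmetric positive semidefinite square root (for symmetric positive
  semidefinite \<open>K\<close>).\<close>

definition psd_sqrt :: "real^'n^'n \<Rightarrow> real^'n^'n" where
  "psd_sqrt K = (THE S. transpose S = S \<and> (\<forall>x. 0 \<le> x \<bullet> (S *v x)) \<and> S ** S = K)"

section \<open>The H2 norm\<close>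

text \<open>The squared H2 norm of \<open>x' = A x + B \<eta>, y = C x\<close>, as the energy of the impulse response.
  The integrand is continuous and nonnegative, so the extended nonnegative integral needs no
  integrability condition: the value is \<open>\<infinity>\<close> exactly if the integral diverges.\<close>

definition h2_norm_sq :: "real^'s^'s \<Rightarrow> real^'u^'s \<Rightarrow> real^'s^'y \<Rightarrow> ennreal" where
  "h2_norm_sq A B C =
     (\<integral>\<^sup>+ t\<in>{0..}. ennreal (trace (transpose B ** matexp (t *\<^sub>R transpose A) **
        transpose C ** C ** matexp (t *\<^sub>R A) ** B)) \<partial>lborel)"

section \<open>The closed-loop system\<close>

text \<open>The state \<open>(\<theta>, \<omega>, p)\<close> is a vector indexed by the disjoint sum of three copies of the
  node set.\<close>

type_synonym 'n state = "real^('n + 'n + 'n)"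

definition pack :: "real^'n \<Rightarrow> real^'n \<Rightarrow> real^'n \<Rightarrow> 'n state" where
  "pack th om p = (\<chi> s. case s of Inl i \<Rightarrow> th $ i
     | Inr r \<Rightarrow> (case r of Inl i \<Rightarrow> om $ i | Inr i \<Rightarrow> p $ i))"

definition theta_part :: "'n state \<Rightarrow> real^'n" where
  "theta_part x = (\<chi> i. x $ Inl i)"

definition omega_part :: "'n state \<Rightarrow> real^'n" where
  "omega_part x = (\<chi> i. x $ Inr (Inl i))"

definition p_part :: "'n state \<Rightarrow> real^'n" where
  "p_part x = (\<chi> i. x $ Inr (Inr i))"

text \<open>State-space form of
    \<open>\<theta>' = \<omega>\<close>,
    \<open>M \<omega>' = - L \<theta> - D \<omega> + p + B1 \<eta>\<close>,
    \<open>T K p' = - \<omega> - Lc K p\<close>,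
    \<open>y = K\<^sup>1\<^sup>/\<^sup>2 p\<close>
  with \<open>M\<close> and \<open>T K\<close> invertible.\<close>

definition sys_A :: "real^'n^'n \<Rightarrow> real^'n^'n \<Rightarrow> real^'n^'n \<Rightarrow> real^'n^'n \<Rightarrow> real^'n^'n \<Rightarrow>
    real^'n^'n \<Rightarrow> real^('n + 'n + 'n)^('n + 'n + 'n)" where
  "sys_A L M D K T Lc = matrix (\<lambda>x. pack
     (omega_part x)
     (matrix_inv M *v (- (L *v theta_part x) - D *v omega_part x + p_part x))
     (matrix_inv (T ** K) *v (- omega_part x - (Lc ** K) *v p_part x)))"

definition sys_B :: "real^'n^'n \<Rightarrow> real^'n^'n \<Rightarrow> real^'n^('n + 'n + 'n)" where
  "sys_B M B1 = matrix (\<lambda>\<eta>. pack 0 (matrix_inv M *v (B1 *v \<eta>)) 0)"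

definition sys_C :: "real^'n^'n \<Rightarrow> real^('n + 'n + 'n)^'n" where
  "sys_C K = matrix (\<lambda>x. psd_sqrt K *v p_part x)"

definition sys_h2_sq :: "real^'n^'n \<Rightarrow> real^'n^'n \<Rightarrow> real^'n^'n \<Rightarrow> real^'n^'n \<Rightarrow> real^'n^'n \<Rightarrow>
    real^'n^'n \<Rightarrow> real^'n^'n \<Rightarrow> ennreal" where
  "sys_h2_sq L M D K B1 T Lc = h2_norm_sq (sys_A L M D K T Lc) (sys_B M B1) (sys_C K)"

end

(*
  Modal decomposition. The Laplacian is symmetric, so it has an orthonormal eigenbasis q_i, and in
  these coordinates the closed loop splits into scalar third-order systems, one per eigenvalue l.
  Expanding trace(N^T N) of the impulse response N(t) in the basis q turns the H2 norm into the sum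
  of the output energies of the modes. Each energy is read off from an explicit quadratic form V
  (the observability Gramian of the mode) with V' = - k p^2, once V tends to 0 along the impulse
  response. That decay needs a strict Lyapunov function. For l = 0 the angle is not asymptotically
  stable, but it is then unobservable and drops out of V, so only omega and p have to decay.
*)
theory Submission
  imports Defs
begin

section \<open>The matrix exponential\<close>

text \<open>The Gramian form V cannot supply its own decay: V' = - k p^2 only makes V nonincreasing
  and leaves its limit open. The physical energy of a mode has the same defect, its derivative being
  - d omega^2 - gamma l k p^2: it misses theta when l > 0, and it misses p when l = 0. Hence two
  decay arguments, each adding to the energy a different cross term with a small factor. The
  denominator z2 l^2 + z1 l + 1 comes from solving V' = - k p^2 monomial by monomial; it is what
  remains when every coefficient but one has been eliminated. An impulse along q_j only sets omega
  to (b / m) q_j, so every mode i other than j has zero output energy and the double sum from the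
  trace collapses to its diagonal. Connectedness makes the eigenvalue 0 simple. So exactly one term
  of the final sum is independent of gamma, and this term alone survives the high-gain limit. Two
  indexings of the spectrum occur: by nodes, from the eigenbasis, and by rank, in the statement.
  They are reconciled as multisets of roots of the characteristic polynomial.\<close>

lemma matpow_0 [simp]: "matpow A 0 = mat 1"
  by (simp add: matpow_def)

lemma matpow_Suc: "matpow A (Suc k) = A ** matpow A k"
  by (simp add: matpow_def)

lemma matpow_Suc2: "matpow A (Suc k) = matpow A k ** A"
proof (induction k)
  case (Suc k)
  then show ?case by (metis matpow_Suc matrix_mul_assoc)
qed (simp add: matpow_Suc)

lemma transpose_matpow: "transpose (matpow A k) = matpow (transpose A) k"
  by (induction k) (simp_all add: matpow_Suc matrix_transpose_mul flip: matpow_Suc2)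

lemma matpow_scaleR: "matpow (t *\<^sub>R A) k = t ^ k *\<^sub>R matpow A k"
  by (induction k) (simp_all add: matpow_Suc vec_eq_iff matrix_matrix_mult_def sum_distrib_left mult_ac)

text \<open>The sum of all absolute entries dominates every absolute row sum, so each multiplication
  by \<open>A\<close> enlarges the largest entry by at most this factor.\<close>

lemma matpow_entry_bound:
  fixes A :: "real^'n^'n"
  obtains c where "c \<ge> 0" "\<And>k i j. \<bar>matpow A k $ i $ j\<bar> \<le> c ^ k"
proof
  define b where "b = (\<Sum>i\<in>UNIV. \<Sum>j\<in>UNIV. \<bar>A $ i $ j\<bar>)"
  show "b \<ge> 0" unfolding b_def by (intro sum_nonneg) simp
  show "\<bar>matpow A k $ i $ j\<bar> \<le> b ^ k" for k i j
  proof (induction k arbitrary: i j)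
    case 0
    show ?case by (simp add: mat_def)
  next
    case (Suc k)
    have "\<bar>matpow A (Suc k) $ i $ j\<bar> \<le> (\<Sum>l\<in>UNIV. \<bar>A $ i $ l\<bar> * \<bar>matpow A k $ l $ j\<bar>)"
      unfolding matpow_Suc matrix_matrix_mult_def by (simp flip: abs_mult)
    also have "\<dots> \<le> (\<Sum>l\<in>UNIV. \<bar>A $ i $ l\<bar> * b ^ k)"
      by (intro sum_mono mult_left_mono Suc.IH) auto
    also have "\<dots> = (\<Sum>l\<in>UNIV. \<bar>A $ i $ l\<bar>) * b ^ k" by (simp add: sum_distrib_right)
    also have "\<dots> \<le> b * b ^ k"
      unfolding b_def using \<open>b \<ge> 0\<close>
      by (intro mult_right_mono member_le_sum[of i UNIV "\<lambda>i. \<Sum>j\<in>UNIV. \<bar>A $ i $ j\<bar>"])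
        (simp_all add: sum_nonneg)
    finally show ?case by simp
  qed
qed

text \<open>Dominated by the exponential series at \<open>c * \<bar>t\<bar>\<close>. Each entry is
  put in the shape of a scalar power series in \<open>t\<close>, which makes termwise
  differentiation available.\<close>

lemma summable_matexp_entry:
  "summable (\<lambda>k. matpow A k $ i $ j / fact k * t ^ k)"
proof -
  obtain c where c: "c \<ge> 0" "\<And>k i j. \<bar>matpow A k $ i $ j\<bar> \<le> c ^ k"
    using matpow_entry_bound by blast
  have "norm (matpow A k $ i $ j / fact k * t ^ k) \<le> (c * \<bar>t\<bar>) ^ k /\<^sub>R fact k" for k
    using c(2)[of k i j] by (simp add: abs_mult power_mult_distrib power_abs divide_simps mult_right_mono)
  then show ?thesis
    by (intro summable_comparison_test'[OF summable_exp_generic[of "c * \<bar>t\<bar>"]]) blast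
qed

lemma matexp_sums: "(\<lambda>k. (1 / fact k) *\<^sub>R matpow A k) sums matexp A"
proof -
  have "summable (\<lambda>k. (1 / fact k) *\<^sub>R matpow A k)"
  proof -
    define S where "S = (\<chi> i j. \<Sum>k. matpow A k $ i $ j / fact k)"
    have "(\<lambda>k. ((1 / fact k) *\<^sub>R matpow A k) $ i $ j) sums S $ i $ j" for i j
      using summable_matexp_entry[of A i j 1] by (simp add: S_def summable_sums)
    then have "(\<lambda>k. (1 / fact k) *\<^sub>R matpow A k) sums S"
      unfolding sums_def by (intro vec_tendstoI) simp
    then show ?thesis by (rule sums_summable)
  qed
  then show ?thesis unfolding matexp_def by (rule summable_sums)
qed

lemma matexp_scaleR_entry_sums:
  "(\<lambda>k. matpow A k $ i $ j / fact k * t ^ k) sums matexp (t *\<^sub>R A) $ i $ j"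
proof -
  have "(\<lambda>k. ((1 / fact k) *\<^sub>R matpow (t *\<^sub>R A) k) $ i $ j) sums matexp (t *\<^sub>R A) $ i $ j"
    using matexp_sums[of "t *\<^sub>R A", unfolded sums_def, THEN tendsto_vec_nth, THEN tendsto_vec_nth, of i j]
    unfolding sums_def by (simp add: sum_component)
  then show ?thesis by (simp add: matpow_scaleR mult.commute)
qed

lemma matexp_0: "matexp 0 = mat 1"
proof -
  have "(\<lambda>k. (1 / fact k) *\<^sub>R matpow 0 k) sums (mat 1 :: real^'n^'n)"
  proof -
    have "(1 / fact k) *\<^sub>R matpow (0 :: real^'n^'n) k = (if k = 0 then mat 1 else 0)" for k
      by (cases k) (simp_all add: matpow_Suc)
    then show ?thesis using sums_If_finite_set[of "{0::nat}" "\<lambda>_. mat 1 :: real^'n^'n"] by simp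
  qed
  then show ?thesis using matexp_sums sums_unique2 by blast
qed

lemma transpose_matexp: "transpose (matexp A) = matexp (transpose A)"
proof -
  have "bounded_linear (transpose :: real^'n^'n \<Rightarrow> real^'n^'n)"
    by (intro linear_conv_bounded_linear[THEN iffD1] linearI)
      (simp_all add: vec_eq_iff transpose_def)
  from bounded_linear.sums[OF this matexp_sums[of A]]
  have "(\<lambda>k. (1 / fact k) *\<^sub>R matpow (transpose A) k) sums transpose (matexp A)"
    by (simp add: transpose_scalar transpose_matpow)
  then show ?thesis using matexp_sums sums_unique2 by blast
qed

text \<open>Termwise differentiation shifts the coefficients by one, so
  \<open>matpow A (Suc k)\<close> appears over \<open>fact k\<close>; its leading factor
  \<open>A\<close> is then pulled out of the series.\<close>

lemma has_real_derivative_matexp_entry: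
  "((\<lambda>t. matexp (t *\<^sub>R A) $ i $ j) has_real_derivative (A ** matexp (t *\<^sub>R A)) $ i $ j) (at t)"
proof -
  let ?c = "\<lambda>i j k. matpow A k $ i $ j / fact k"
  have E: "matexp (t *\<^sub>R A) $ i $ j = (\<Sum>k. ?c i j k * t ^ k)" for t i j
    using matexp_scaleR_entry_sums by (rule sums_unique)
  have "diffs (?c i j) k = (\<Sum>l\<in>UNIV. A $ i $ l * ?c l j k)" for k
  proof -
    have "diffs (?c i j) k = matpow A (Suc k) $ i $ j / fact k"
      by (simp add: diffs_def del: of_nat_Suc)
    then show ?thesis by (simp add: matpow_Suc matrix_matrix_mult_def sum_divide_distrib)
  qed
  then have "(\<Sum>k. diffs (?c i j) k * t ^ k) = (\<Sum>k. \<Sum>l\<in>UNIV. A $ i $ l * (?c l j k * t ^ k))"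
    by (simp add: sum_distrib_right mult.assoc)
  also have "\<dots> = (\<Sum>l\<in>UNIV. A $ i $ l * (\<Sum>k. ?c l j k * t ^ k))"
    by (subst suminf_sum[OF summable_mult[OF summable_matexp_entry]])
      (simp only: suminf_mult[OF summable_matexp_entry])
  also have "\<dots> = (A ** matexp (t *\<^sub>R A)) $ i $ j"
    by (simp add: matrix_matrix_mult_def E)
  finally show ?thesis
    using termdiffs_strong_converges_everywhere[OF summable_matexp_entry, of A i j t] by (simp add: E)
qed

lemma has_vector_derivative_matexp:
  "((\<lambda>t. matexp (t *\<^sub>R A) *v x) has_vector_derivative A *v (matexp (t *\<^sub>R A) *v x)) (at t)"
proof -
  have "((\<lambda>t. (matexp (t *\<^sub>R A) *v x) $ i) has_real_derivative (A *v (matexp (t *\<^sub>R A) *v x)) $ i) (at t)" for i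
    unfolding matrix_vector_mul_assoc unfolding matrix_vector_mult_def
    by (auto intro!: derivative_eq_intros has_real_derivative_matexp_entry)
  then show ?thesis
    unfolding has_vector_derivative_def has_real_derivative_iff_has_vector_derivative
    by (subst has_derivative_componentwise_within) (auto simp: Basis_vec_def inner_axis)
qed

section \<open>Symmetric matrices\<close>

text \<open>A maximiser \<open>v\<close> of the Rayleigh quotient on the unit sphere of
  \<open>S\<close> is an eigenvector: the form c |x|^2 - x . f x is nonnegative on \<open>S\<close>
  and vanishes at \<open>v\<close>, so its first variation there vanishes. Invariance of
  \<open>S\<close> keeps the test direction \<open>w\<close> inside \<open>S\<close>.\<close>

lemma Rayleigh_eigenvector:
  fixes f :: "'a::euclidean_space \<Rightarrow> 'a"
  assumes f: "linear f" and sym: "\<And>x y. f x \<bullet> y = x \<bullet> f y"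
    and S: "subspace S" and inv: "f ` S \<subseteq> S" and "S \<noteq> {0}"
  obtains v c where "v \<in> S" "norm v = 1" "f v = c *\<^sub>R v"
proof -
  obtain u where u: "u \<in> S" "u \<noteq> 0" using S \<open>S \<noteq> {0}\<close> subspace_0 by blast
  have "compact (S \<inter> sphere 0 1)"
    using closed_subspace[OF S] by (simp add: closed_Int_compact)
  moreover have "u /\<^sub>R norm u \<in> S \<inter> sphere 0 1"
    using u subspace_scale[OF S] by auto
  moreover have "continuous_on (S \<inter> sphere 0 1) (\<lambda>x. x \<bullet> f x)"
    using f by (intro continuous_intros linear_continuous_on linear_conv_bounded_linear[THEN iffD1])
  ultimately obtain v where v: "v \<in> S" "norm v = 1"
    and max: "\<And>x. x \<in> S \<Longrightarrow> norm x = 1 \<Longrightarrow> x \<bullet> f x \<le> v \<bullet> f v"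
    using continuous_attains_sup[of "S \<inter> sphere 0 1" "\<lambda>x. x \<bullet> f x"] by fastforce
  define c where "c = v \<bullet> f v"
  have ge: "0 \<le> c * (x \<bullet> x) - x \<bullet> f x" if "x \<in> S" for x
  proof (cases "x = 0")
    case False
    have "(x /\<^sub>R norm x) \<bullet> f (x /\<^sub>R norm x) \<le> c"
      unfolding c_def using False that subspace_scale[OF S] by (intro max) auto
    then have "inverse (norm x) * inverse (norm x) * (x \<bullet> f x) \<le> c"
      using f by (simp add: linear_cmul mult.assoc)
    then show ?thesis using False
      by (simp add: dot_square_norm power2_eq_square field_simps)
  qed (use f in \<open>simp add: linear_0\<close>)
  define w where "w = c *\<^sub>R v - f v"
  have w: "w \<in> S"
    using v inv S unfolding w_def by (intro subspace_diff subspace_scale) auto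
  have quad: "0 \<le> (2 * t) * (w \<bullet> w) + t\<^sup>2 * (c * (w \<bullet> w) - w \<bullet> f w)" for t :: real
  proof -
    have "0 \<le> c * ((v + t *\<^sub>R w) \<bullet> (v + t *\<^sub>R w)) - (v + t *\<^sub>R w) \<bullet> f (v + t *\<^sub>R w)"
      using v w S by (intro ge subspace_add subspace_scale)
    also have "\<dots> = c * (v \<bullet> v) - v \<bullet> f v + 2 * t * (c * (v \<bullet> w) - f v \<bullet> w)
        + t\<^sup>2 * (c * (w \<bullet> w) - w \<bullet> f w)"
      using f sym[of v w] inner_commute[of w "f v"] inner_commute[of w v]
      by (simp add: linear_add linear_cmul inner_add power2_eq_square algebra_simps)
    also have "c * (v \<bullet> v) - v \<bullet> f v = 0" using v by (simp add: c_def dot_square_norm)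
    also have "c * (v \<bullet> w) - f v \<bullet> w = w \<bullet> w" by (simp add: w_def inner_diff inner_commute right_diff_distrib)
    finally show ?thesis by simp
  qed
  have "w \<bullet> w = 0"
  proof (rule ccontr)
    assume "w \<bullet> w \<noteq> 0"
    then have pos: "w \<bullet> w > 0" by simp
    \<comment> \<open>A positive upper bound for the coefficient of \<open>t\<^sup>2\<close> in
      \<open>quad\<close>. The \<open>t\<close> below minimises the resulting parabola, whose
      minimum would be negative.\<close>
    define a where "a = \<bar>c * (w \<bullet> w) - w \<bullet> f w\<bar> + 1"
    have "a > 0" by (simp add: a_def)
    define t where "t = - (w \<bullet> w) / a"
    have "c * (w \<bullet> w) - w \<bullet> f w \<le> a" unfolding a_def by linarith
    then have "0 \<le> (2 * t) * (w \<bullet> w) + t\<^sup>2 * a"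
      using quad[of t] mult_left_mono[of "c * (w \<bullet> w) - w \<bullet> f w" a "t\<^sup>2"] by fastforce
    also have "\<dots> = - (w \<bullet> w)\<^sup>2 / a"
      using \<open>a > 0\<close> by (simp add: t_def power2_eq_square field_simps)
    finally show False using pos \<open>a > 0\<close> by (simp add: field_simps)
  qed
  then have "f v = c *\<^sub>R v" by (simp add: w_def)
  with v that show ?thesis by blast
qed

text \<open>Induction on the dimension: one unit eigenvector is split off, and by symmetry its
  orthogonal complement within \<open>S\<close> is again invariant. The statement ranges over
  invariant subspaces so that the induction hypothesis applies to that complement.\<close>

lemma orthonormal_eigenbasis_subspace:
  fixes f :: "'a::euclidean_space \<Rightarrow> 'a"
  assumes f: "linear f" and sym: "\<And>x y. f x \<bullet> y = x \<bullet> f y"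
    and "subspace S" and "f ` S \<subseteq> S"
  shows "\<exists>B\<subseteq>S. pairwise orthogonal B \<and> (\<forall>v\<in>B. norm v = 1 \<and> (\<exists>c. f v = c *\<^sub>R v)) \<and>
    finite B \<and> card B = dim S"
  using assms(3,4)
proof (induction "dim S" arbitrary: S)
  case 0
  then show ?case by (intro exI[of _ "{}"]) auto
next
  case (Suc n)
  then have "S \<noteq> {0}" by auto
  then obtain v c where v: "v \<in> S" "norm v = 1" "f v = c *\<^sub>R v"
    using Rayleigh_eigenvector[OF f sym] Suc.prems by blast
  define T where "T = {y \<in> S. \<forall>x\<in>span {v}. orthogonal x y}"
  have T: "T = {y \<in> S. v \<bullet> y = 0}"
    by (auto simp: T_def orthogonal_def span_singleton)
  have "dim (span {v}) = 1" using v by (auto simp: dim_insert)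
  moreover have "dim T + dim (span {v}) = dim S"
    unfolding T_def using v Suc.prems(1)
    by (intro dim_subspace_orthogonal_to_vectors) (auto intro: span_minimal[THEN subsetD])
  ultimately have dim: "n = dim T" using Suc.hyps(2) by simp
  have "subspace T"
    unfolding T using Suc.prems(1)
    by (auto simp: subspace_def inner_add_right)
  moreover have "f ` T \<subseteq> T"
    using Suc.prems(2) v sym[of v, symmetric] by (auto simp: T)
  ultimately obtain B where B: "B \<subseteq> T" "pairwise orthogonal B"
    "\<forall>v\<in>B. norm v = 1 \<and> (\<exists>c. f v = c *\<^sub>R v)" "finite B" "card B = n"
    using Suc.hyps(1)[OF dim] dim by blast
  have "v \<notin> B"
  proof
    assume "v \<in> B"
    then have "v \<bullet> v = 0" using B(1) by (auto simp: T)
    then show False using v by simp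
  qed
  then show ?case
    using B v Suc.hyps(2)
    by (intro exI[of _ "insert v B"])
      (auto simp: T pairwise_insert orthogonal_def inner_commute subset_iff)
qed

text \<open>The basis has as many vectors as the type \<open>'n\<close> has elements, so the nodes
  themselves can serve as its index set.\<close>

lemma symmetric_matrix_eigenbasis:
  fixes A :: "real^'n^'n"
  assumes A: "transpose A = A"
  shows "\<exists>(q :: 'n \<Rightarrow> real^'n) \<mu>.
    (\<forall>i j. q i \<bullet> q j = (if i = j then 1 else 0)) \<and> (\<forall>i. A *v q i = \<mu> i *\<^sub>R q i)"
proof -
  have sym: "(A *v x) \<bullet> y = x \<bullet> (A *v y)" for x y
    by (metis A dot_lmul_matrix vector_transpose_matrix)
  obtain B where B: "pairwise orthogonal B" "finite B" "card B = CARD('n)"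
    "\<forall>v\<in>B. norm v = 1 \<and> (\<exists>c. A *v v = c *\<^sub>R v)"
    using orthonormal_eigenbasis_subspace[OF matrix_vector_mul_linear sym, of UNIV] by auto
  then obtain q where q: "bij_betw q (UNIV :: 'n set) B"
    using finite_same_card_bij[of "UNIV :: 'n set" B] by auto
  then have qB: "q i \<in> B" for i by (auto simp: bij_betw_def)
  have "\<forall>i. \<exists>c. A *v q i = c *\<^sub>R q i" using B qB by blast
  then obtain \<mu> where "\<And>i. A *v q i = \<mu> i *\<^sub>R q i" by metis
  moreover have "q i \<bullet> q j = (if i = j then 1 else 0)" for i j
  proof (cases "i = j")
    case False
    then have "q i \<noteq> q j" using q by (auto simp: bij_betw_def inj_on_def)
    then show ?thesis using B(1) qB False by (auto simp: pairwise_def orthogonal_def)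
  qed (use B(4) qB in \<open>auto simp: norm_eq_1\<close>)
  ultimately show ?thesis by blast
qed

lemma orthonormal_family_matrix:
  fixes q :: "'n::finite \<Rightarrow> real^'n"
  assumes "\<And>i j. q i \<bullet> q j = (if i = j then 1 else 0)"
  shows "transpose (\<chi> r c. q c $ r) ** (\<chi> r c. q c $ r) = mat 1"
    "(\<chi> r c. q c $ r) ** transpose (\<chi> r c. q c $ r) = mat 1"
proof -
  show 1: "transpose (\<chi> r c. q c $ r) ** (\<chi> r c. q c $ r) = mat 1"
    using assms by (simp add: vec_eq_iff matrix_matrix_mult_def transpose_def mat_def inner_vec_def)
  then show "(\<chi> r c. q c $ r) ** transpose (\<chi> r c. q c $ r) = mat 1"
    using matrix_left_right_inverse by blast
qed

text \<open>With the eigenvectors as columns of \<open>P\<close>, the matrix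
  \<open>mat x - A\<close> satisfies (x I - A) P = P D with \<open>D\<close> diagonal, and det P can
  be cancelled because P is orthogonal.\<close>

lemma det_mat_minus_eigenbasis:
  fixes q :: "'n::finite \<Rightarrow> real^'n"
  assumes q: "\<And>i j. q i \<bullet> q j = (if i = j then 1 else 0)" and A: "\<And>i. A *v q i = \<mu> i *\<^sub>R q i"
  shows "det (mat x - A) = (\<Prod>i\<in>UNIV. x - \<mu> i)"
proof -
  define P :: "real^'n^'n" where "P = (\<chi> r c. q c $ r)"
  define D :: "real^'n^'n" where "D = (\<chi> i j. if i = j then x - \<mu> i else 0)"
  have "(mat x - A) ** P = P ** D"
  proof -
    have "((mat x - A) ** P) $ r $ c = (P ** D) $ r $ c" for r c
    proof -
      have "((mat x - A) ** P) $ r $ c = ((mat x - A) *v q c) $ r"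
        by (simp add: matrix_matrix_mult_def matrix_vector_mult_def P_def)
      also have "\<dots> = x * q c $ r - \<mu> c * q c $ r"
      proof -
        have "mat x *v q c = x *\<^sub>R q c"
          by (simp add: vec_eq_iff matrix_vector_mult_def mat_def if_distrib[of "\<lambda>y. y * _"] cong: if_cong)
        then show ?thesis by (simp add: matrix_vector_mult_diff_rdistrib A)
      qed
      also have "\<dots> = (P ** D) $ r $ c"
        by (simp add: matrix_matrix_mult_def P_def D_def if_distrib[of "(*) _"] algebra_simps cong: if_cong)
      finally show ?thesis .
    qed
    then show ?thesis by (simp add: vec_eq_iff)
  qed
  then have "det (mat x - A) * det P = det P * det D" by (metis det_mul)
  moreover have "det P \<noteq> 0"
    using orthonormal_family_matrix(1)[OF q] unfolding P_def
    by (metis det_I det_mul mult_zero_right zero_neq_one)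
  moreover have "det D = (\<Prod>i\<in>UNIV. x - \<mu> i)"
    by (subst det_diagonal) (auto simp: D_def)
  ultimately show ?thesis by simp
qed

text \<open>Real polynomials that agree as functions are equal, and equal polynomials have the same
  roots counted with multiplicity.\<close>

lemma image_mset_eq_of_linear_factors:
  fixes a :: "'i \<Rightarrow> real" and b :: "'j \<Rightarrow> real"
  assumes "finite I" "finite J"
    and eq: "\<And>x. (\<Prod>i\<in>I. x - a i) = (\<Prod>j\<in>J. x - b j)"
  shows "image_mset a (mset_set I) = image_mset b (mset_set J)"
proof -
  have *: "proots (\<Prod>i\<in>I. [:- a i, 1:]) = image_mset a (mset_set I)" if "finite I"
    for I and a :: "'k \<Rightarrow> real"
    using that by (subst proots_prod) (auto simp: sum_unfold_sum_mset)
  have "poly (\<Prod>i\<in>I. [:- a i, 1:]) = poly (\<Prod>j\<in>J. [:- b j, 1:])"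
    using eq by (simp add: fun_eq_iff poly_prod)
  then have "(\<Prod>i\<in>I. [:- a i, 1:]) = (\<Prod>j\<in>J. [:- b j, 1:])"
    by (rule poly_eq_poly_eq_iff[THEN iffD1])
  then show ?thesis using * assms(1,2) by metis
qed

text \<open>The trace is the squared Frobenius norm of \<open>N\<close>, which is invariant under
  the orthogonal change of basis from \<open>N\<close> to \<open>Q\<close>.\<close>

lemma trace_transpose_mult_eigenbasis:
  fixes q :: "'n::finite \<Rightarrow> real^'n" and N :: "real^'n^'n"
  assumes q: "\<And>i j. q i \<bullet> q j = (if i = j then 1 else 0)"
  shows "trace (transpose N ** N) = (\<Sum>i\<in>UNIV. \<Sum>j\<in>UNIV. (q i \<bullet> (N *v q j))\<^sup>2)"
proof -
  define P :: "real^'n^'n" where "P = (\<chi> r c. q c $ r)"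
  have P: "P ** transpose P = mat 1" unfolding P_def by (rule orthonormal_family_matrix(2)[OF q])
  define Q where "Q = transpose P ** N ** P"
  have Qij: "Q $ i $ j = q i \<bullet> (N *v q j)" for i j
    unfolding Q_def matrix_mul_assoc[symmetric]
    by (simp add: matrix_matrix_mult_def transpose_def P_def inner_vec_def matrix_vector_mult_def)
  have "transpose Q ** Q = transpose P ** (transpose N ** (P ** transpose P) ** N ** P)"
    by (simp add: Q_def matrix_transpose_mul matrix_mul_assoc)
  also have "\<dots> = transpose P ** (transpose N ** N ** P)" by (simp add: P)
  finally have "trace (transpose Q ** Q) = trace (transpose N ** N ** P ** transpose P)"
    by (metis trace_mul_sym)
  also have "\<dots> = trace (transpose N ** N)"
    by (metis P matrix_mul_assoc matrix_mul_rid)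
  finally have "trace (transpose N ** N) = trace (transpose Q ** Q)" by simp
  also have "\<dots> = (\<Sum>j\<in>UNIV. \<Sum>i\<in>UNIV. (Q $ i $ j)\<^sup>2)"
    by (simp add: trace_def matrix_matrix_mult_def transpose_def power2_eq_square)
  also have "\<dots> = (\<Sum>i\<in>UNIV. \<Sum>j\<in>UNIV. (q i \<bullet> (N *v q j))\<^sup>2)"
    by (subst sum.swap) (simp add: Qij)
  finally show ?thesis .
qed

section \<open>The weighted Laplacian\<close>

lemma transpose_laplacian: "transpose (laplacian E w) = laplacian E w"
  by (auto simp: laplacian_def transpose_def vec_eq_iff insert_commute)

text \<open>Edge weights extended by zero to all ordered pairs, so that sums over edges become sums
  over all nodes without side conditions.\<close>

definition adj_weight :: "'n set set \<Rightarrow> ('n set \<Rightarrow> real) \<Rightarrow> 'n \<Rightarrow> 'n \<Rightarrow> real" where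
  "adj_weight E w i j = (if i \<noteq> j \<and> {i, j} \<in> E then w {i, j} else 0)"

lemma adj_weight_commute: "adj_weight E w i j = adj_weight E w j i"
  by (simp add: adj_weight_def insert_commute)

text \<open>In a simple graph an edge at \<open>i\<close> is determined by its other
  endpoint.\<close>

lemma sum_incident_edges:
  fixes E :: "'n::finite set set"
  assumes "simple_graph E"
  shows "(\<Sum>e\<in>{e\<in>E. i \<in> e}. w e) = (\<Sum>j\<in>UNIV. adj_weight E w i j)"
proof -
  have "bij_betw (\<lambda>j. {i, j}) {j. i \<noteq> j \<and> {i, j} \<in> E} {e\<in>E. i \<in> e}"
  proof (rule bij_betwI')
    fix e assume e: "e \<in> {e\<in>E. i \<in> e}"
    then have "card e = 2" using assms by (auto simp: simple_graph_def)
    then obtain j where "e = {i, j}" "i \<noteq> j"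
      using e by (auto simp: card_2_iff)
    then show "\<exists>j\<in>{j. i \<noteq> j \<and> {i, j} \<in> E}. e = {i, j}" using e by auto
  qed (auto simp: doubleton_eq_iff)
  then have "(\<Sum>e\<in>{e\<in>E. i \<in> e}. w e) = (\<Sum>j\<in>{j. i \<noteq> j \<and> {i, j} \<in> E}. w {i, j})"
    by (rule sum.reindex_bij_betw[symmetric])
  also have "\<dots> = (\<Sum>j\<in>UNIV. adj_weight E w i j)"
    unfolding adj_weight_def by (subst sum.inter_filter[symmetric]) simp_all
  finally show ?thesis .
qed

lemma laplacian_mult_nth:
  fixes E :: "'n::finite set set"
  assumes "simple_graph E"
  shows "(laplacian E w *v x) $ i = (\<Sum>j\<in>UNIV. adj_weight E w i j * (x $ i - x $ j))"
proof -
  have "laplacian E w $ i $ j * x $ j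
    = (if j = i then (\<Sum>j\<in>UNIV. adj_weight E w i j) * x $ i else 0) - adj_weight E w i j * x $ j" for j
    using sum_incident_edges[OF assms, where i = i and w = w]
    by (simp add: laplacian_def adj_weight_def)
  then show ?thesis
    by (simp add: matrix_vector_mult_def sum_subtractf right_diff_distrib sum_distrib_right)
qed

text \<open>This is the Dirichlet energy. Exchanging the two summation indices and averaging
  symmetrises the sum; the division by 2 accounts for every edge being counted in both
  directions.\<close>

lemma laplacian_quadratic_form:
  fixes E :: "'n::finite set set"
  assumes "simple_graph E"
  shows "x \<bullet> (laplacian E w *v x)
    = (\<Sum>i\<in>UNIV. \<Sum>j\<in>UNIV. adj_weight E w i j * (x $ i - x $ j)\<^sup>2) / 2"
proof -
  let ?a = "adj_weight E w"
  have "x \<bullet> (laplacian E w *v x) = (\<Sum>i\<in>UNIV. \<Sum>j\<in>UNIV. ?a i j * (x $ i * (x $ i - x $ j)))"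
    by (simp add: inner_vec_def laplacian_mult_nth[OF assms] sum_distrib_left mult.left_commute)
  moreover have "\<dots> = (\<Sum>i\<in>UNIV. \<Sum>j\<in>UNIV. ?a i j * (x $ j * (x $ j - x $ i)))"
    by (subst sum.swap) (simp add: adj_weight_commute)
  moreover have "(\<Sum>i\<in>UNIV. \<Sum>j\<in>UNIV. ?a i j * (x $ i - x $ j)\<^sup>2)
    = (\<Sum>i\<in>UNIV. \<Sum>j\<in>UNIV. ?a i j * (x $ i * (x $ i - x $ j)))
      + (\<Sum>i\<in>UNIV. \<Sum>j\<in>UNIV. ?a i j * (x $ j * (x $ j - x $ i)))"
    unfolding sum.distrib[symmetric] by (simp add: power2_eq_square algebra_simps)
  ultimately show ?thesis by simp
qed

lemma adj_weight_nonneg: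
  assumes "\<forall>e\<in>E. 0 < w e"
  shows "0 \<le> adj_weight E w i j"
  using assms by (auto simp: adj_weight_def intro: less_imp_le)

lemma laplacian_psd:
  fixes E :: "'n::finite set set"
  assumes "simple_graph E" "\<forall>e\<in>E. 0 < w e"
  shows "0 \<le> x \<bullet> (laplacian E w *v x)"
  unfolding laplacian_quadratic_form[OF assms(1)]
  using adj_weight_nonneg[OF assms(2)] by (simp add: sum_nonneg)

text \<open>A kernel vector has zero Dirichlet energy, so each nonnegative term vanishes and the
  vector does not change across any edge; connectedness carries this along a path.\<close>

lemma laplacian_kernel_const:
  fixes E :: "'n::finite set set"
  assumes E: "simple_graph E" and w: "\<forall>e\<in>E. 0 < w e" and conn: "graph_connected E"
    and x: "laplacian E w *v x = 0"
  shows "x $ u = x $ v"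
proof -
  let ?a = "adj_weight E w"
  have nn: "0 \<le> ?a i j * (x $ i - x $ j)\<^sup>2" for i j
    using adj_weight_nonneg[OF w] by simp
  have "(\<Sum>i\<in>UNIV. \<Sum>j\<in>UNIV. ?a i j * (x $ i - x $ j)\<^sup>2) = 0"
    using laplacian_quadratic_form[OF E, of x w] x by simp
  then have zero: "?a i j * (x $ i - x $ j)\<^sup>2 = 0" for i j
    by (simp add: sum_nonneg_eq_0_iff nn sum_nonneg)
  have step: "x $ i = x $ j" if "{i, j} \<in> E" for i j
    using zero[of i j] that w by (cases "i = j") (auto simp: adj_weight_def)
  have "(u, v) \<in> {(i, j). {i, j} \<in> E}\<^sup>*" using conn by (simp add: graph_connected_def)
  then show ?thesis by induction (auto dest: step)
qed

text \<open>The all-ones vector lies in the kernel, so some \<open>\<mu> i0\<close> vanishes. A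
  second zero would give two orthogonal constant vectors, and one of them would have to be
  0.\<close>

lemma laplacian_eigenvalues:
  fixes E :: "'n::finite set set" and q :: "'n \<Rightarrow> real^'n"
  assumes E: "simple_graph E" and w: "\<forall>e\<in>E. 0 < w e" and conn: "graph_connected E"
    and q: "\<And>i j. q i \<bullet> q j = (if i = j then 1 else 0)"
    and \<mu>: "\<And>i. laplacian E w *v q i = \<mu> i *\<^sub>R q i"
    and det: "\<And>x. det (mat x - laplacian E w) = (\<Prod>i\<in>UNIV. x - \<mu> i)"
  obtains i0 where "\<mu> i0 = 0" "\<And>i. i \<noteq> i0 \<Longrightarrow> 0 < \<mu> i"
proof -
  let ?L = "laplacian E w"
  have nonneg: "0 \<le> \<mu> i" for i
    using laplacian_psd[OF E w, of "q i"] by (simp add: \<mu> q)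
  have one: "?L *v 1 = 0" by (simp add: vec_eq_iff laplacian_mult_nth[OF E])
  have "\<not> invertible (mat 0 - ?L)"
  proof
    assume "invertible (mat 0 - ?L)"
    then obtain B where "B ** (mat 0 - ?L) = mat 1" unfolding invertible_def by blast
    then have "1 = B *v ((mat 0 - ?L) *v 1)" by (simp add: matrix_vector_mul_assoc)
    also have "\<dots> = 0" unfolding matrix_vector_mult_diff_rdistrib one by simp
    finally show False by simp
  qed
  then have "det (mat 0 - ?L) = 0" using invertible_det_nz by blast
  then have "(\<Prod>i\<in>UNIV. 0 - \<mu> i) = 0" unfolding det .
  then obtain i0 where i0: "\<mu> i0 = 0" by auto
  have "0 < \<mu> i" if "i \<noteq> i0" for i
  proof (rule ccontr)
    assume "\<not> 0 < \<mu> i"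
    then have "\<mu> i = 0" using nonneg[of i] by simp
    define u :: 'n where "u = undefined"
    have const: "q j = (q j $ u) *\<^sub>R 1" if "\<mu> j = 0" for j
      using laplacian_kernel_const[OF E w conn, of "q j" _ u] that by (simp add: \<mu> vec_eq_iff)
    have "(q i $ u * q i0 $ u) * ((1 :: real^'n) \<bullet> 1) = q i \<bullet> q i0"
      by (subst (3 4) const) (simp_all add: i0 \<open>\<mu> i = 0\<close>)
    also have "\<dots> = 0" using that by (simp add: q)
    finally have "q i $ u = 0 \<or> q i0 $ u = 0" by simp
    then have "q i = 0 \<or> q i0 = 0" using const[OF i0] const[OF \<open>\<mu> i = 0\<close>] by auto
    then show False using q[of i i] q[of i0 i0] by auto
  qed
  with i0 that show ?thesis by blast
qed

section \<open>Output energy of a single mode\<close>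

text \<open>The differential form of Gronwall's inequality: \<open>W t * exp (c * t)\<close> is
  nonincreasing, so \<open>W\<close> is squeezed between 0 and a decaying exponential.\<close>

lemma lyapunov_decay:
  fixes W :: "real \<Rightarrow> real"
  assumes der: "\<And>t. t \<ge> 0 \<Longrightarrow> (W has_real_derivative W' t) (at t)"
    and le: "\<And>t. t \<ge> 0 \<Longrightarrow> W' t \<le> - c * W t"
    and nonneg: "\<And>t. t \<ge> 0 \<Longrightarrow> 0 \<le> W t" and "c > 0"
  shows "(W \<longlongrightarrow> 0) at_top"
proof -
  have "W t * exp (c * t) \<le> W 0 * exp (c * 0)" if "t \<ge> 0" for t
  proof (rule DERIV_nonpos_imp_nonincreasing[OF that])
    fix x :: real assume x: "0 \<le> x" "x \<le> t"
    have "((\<lambda>t. W t * exp (c * t)) has_real_derivative (W' x + c * W x) * exp (c * x)) (at x)"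
      by (auto intro!: derivative_eq_intros der x simp: algebra_simps)
    moreover have "(W' x + c * W x) * exp (c * x) \<le> 0"
      using le[OF x(1)] by (intro mult_nonpos_nonneg) auto
    ultimately show "\<exists>y. ((\<lambda>t. W t * exp (c * t)) has_real_derivative y) (at x) \<and> y \<le> 0"
      by blast
  qed
  then have ub: "W t \<le> W 0 * exp (- (c * t))" if "t \<ge> 0" for t
    using that by (simp add: exp_minus divide_simps mult.commute[of t])
  have "((\<lambda>t. W 0 * exp (- (c * t))) \<longlongrightarrow> W 0 * 0) at_top"
    by (intro tendsto_mult tendsto_const filterlim_compose[OF exp_at_bot])
      (auto simp: filterlim_uminus_at_bot
        intro!: filterlim_tendsto_pos_mult_at_top[OF tendsto_const \<open>c > 0\<close>] filterlim_ident)
  then show ?thesis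
    by (intro tendsto_sandwich[of "\<lambda>_. 0" W at_top "\<lambda>t. W 0 * exp (- (c * t))"])
      (auto simp: eventually_at_top_linorder intro!: exI[of _ 0] nonneg ub)
qed

lemma tendsto_0_of_square_le:
  fixes f W :: "real \<Rightarrow> real"
  assumes W: "(W \<longlongrightarrow> 0) at_top" and le: "\<And>t. t \<ge> 0 \<Longrightarrow> C * (f t)\<^sup>2 \<le> W t" and "C > 0"
  shows "(f \<longlongrightarrow> 0) at_top"
proof -
  have "((\<lambda>t. sqrt (W t / C)) \<longlongrightarrow> sqrt (0 / C)) at_top"
    using \<open>C > 0\<close> by (intro tendsto_intros W) auto
  then have lim: "((\<lambda>t. sqrt (W t / C)) \<longlongrightarrow> 0) at_top" by simp
  have "\<bar>f t\<bar> \<le> sqrt (W t / C)" if "t \<ge> 0" for t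
    using le[OF that] \<open>C > 0\<close> by (intro real_le_rsqrt) (simp add: field_simps)
  then have "\<forall>\<^sub>F t in at_top. norm (f t) \<le> sqrt (W t / C)"
    by (auto simp: eventually_at_top_linorder)
  then show ?thesis
    by (rule Lim_null_comparison[OF _ lim])
qed

text \<open>The coordinates of one closed-loop trajectory along a Laplacian eigenvector with
  eigenvalue \<open>l\<close>. Initial values stay free, so an impulse along a different eigenvector
  is also an instance.\<close>

locale swing_mode =
  fixes m d k \<tau> \<gamma> l :: real and \<theta> \<omega> p :: "real \<Rightarrow> real"
  assumes pos: "m > 0" "d > 0" "k > 0" "\<tau> > 0" "\<gamma> > 0"
    and l_nonneg: "l \<ge> 0"
    and d\<theta>: "\<And>t. (\<theta> has_real_derivative \<omega> t) (at t)"
    and d\<omega>: "\<And>t. (\<omega> has_real_derivative (- l * \<theta> t - d * \<omega> t + p t) / m) (at t)"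
    and dp: "\<And>t. (p has_real_derivative (- \<omega> t - \<gamma> * l * k * p t) / (\<tau> * k)) (at t)"
begin

text \<open>Named so that quadratic forms can be differentiated with \<open>m * \<omega>' t\<close>
  and \<open>\<tau> * k * p' t\<close> kept as atoms; these are then replaced by division-free
  expressions.\<close>

definition \<omega>' where "\<omega>' t = (- l * \<theta> t - d * \<omega> t + p t) / m"
definition p' where "p' t = (- \<omega> t - \<gamma> * l * k * p t) / (\<tau> * k)"

lemma d\<omega>': "(\<omega> has_real_derivative \<omega>' t) (at t)"
  using d\<omega> by (simp add: \<omega>'_def)

lemma dp': "(p has_real_derivative p' t) (at t)"
  using dp by (simp add: p'_def)

lemma m_\<omega>': "m * \<omega>' t = - l * \<theta> t - d * \<omega> t + p t"
  using pos by (simp add: \<omega>'_def)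

lemma \<tau>_k_p': "\<tau> * k * p' t = - \<omega> t - \<gamma> * l * k * p t"
  using pos by (simp add: p'_def)

lemma decay_pos:
  assumes "l > 0"
  shows "(\<theta> \<longlongrightarrow> 0) at_top" "(\<omega> \<longlongrightarrow> 0) at_top" "(p \<longlongrightarrow> 0) at_top"
proof -
  \<comment> \<open>The first bound leaves half of the damping of \<open>\<omega>\<close> and keeps
    \<open>W\<close> positive definite. The second lets the damping of \<open>p\<close> absorb the
    mixed term \<open>e * \<theta> t * p t\<close> after a square is completed. In \<open>W\<close>
    below, the extra \<open>d / 2 * (\<theta> t)\<^sup>2\<close> cancels the product of
    \<open>\<theta>\<close> and \<open>\<omega>\<close> that differentiating the cross term
    creates.\<close>
  define e where "e = min (d / (2 * m)) (\<gamma> * l\<^sup>2 * k)"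
  have e: "e > 0" "e * m \<le> d / 2" "e \<le> \<gamma> * l\<^sup>2 * k"
  proof -
    show "e > 0" using pos assms by (auto simp: e_def)
    have "e \<le> d / (2 * m)" by (auto simp: e_def)
    then show "e * m \<le> d / 2" using pos by (simp add: field_simps)
    show "e \<le> \<gamma> * l\<^sup>2 * k" by (auto simp: e_def)
  qed
  \<comment> \<open>The energy alone does not damp \<open>\<theta>\<close>; the \<open>\<theta> \<omega>\<close> cross term makes it strictly decreasing.\<close>
  define W where "W t = l / 2 * (\<theta> t)\<^sup>2 + m / 2 * (\<omega> t)\<^sup>2 + \<tau> * k / 2 * (p t)\<^sup>2
    + e * (m * \<theta> t * \<omega> t + d / 2 * (\<theta> t)\<^sup>2)" for t
  define W' where "W' t = - (d - e * m) * (\<omega> t)\<^sup>2 - \<gamma> * l * k * (p t)\<^sup>2 - e * l * (\<theta> t)\<^sup>2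
    + e * \<theta> t * p t" for t
  have dW: "(W has_real_derivative W' t) (at t)" for t
  proof -
    have "(W has_real_derivative l * \<theta> t * \<omega> t + \<omega> t * (m * \<omega>' t) + p t * (\<tau> * k * p' t)
        + e * (m * \<omega> t * \<omega> t + \<theta> t * (m * \<omega>' t) + d * \<theta> t * \<omega> t)) (at t)"
      unfolding W_def
      by (rule derivative_eq_intros d\<theta> d\<omega>' dp' refl)+ (simp add: algebra_simps)
    then show ?thesis
      unfolding m_\<omega>' \<tau>_k_p' by (simp add: W'_def algebra_simps power2_eq_square)
  qed
  have lower: "W t \<ge> l / 2 * (\<theta> t)\<^sup>2 + m / 4 * (\<omega> t)\<^sup>2 + \<tau> * k / 2 * (p t)\<^sup>2" for t
  proof -
    have "0 \<le> m / 4 * (\<omega> t + 2 * e * \<theta> t)\<^sup>2" using pos by simp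
    moreover have "e * (e * m) * (\<theta> t)\<^sup>2 \<le> e * (d / 2) * (\<theta> t)\<^sup>2"
      using e by (intro mult_right_mono mult_left_mono) auto
    ultimately show ?thesis unfolding W_def by (simp add: power2_eq_square algebra_simps)
  qed
  \<comment> \<open>\<open>c1\<close> bounds \<open>W\<close> above and \<open>c2\<close> bounds the
    dissipation below, both against the plain sum of squares \<open>S\<close>; the decay rate is
    then \<open>c2 / c1\<close>.\<close>
  define c1 where "c1 = max (l / 2 + e * m / 2 + e * d / 2) (max (m / 2 + e * m / 2) (\<tau> * k / 2))"
  have c1: "l / 2 + e * m / 2 + e * d / 2 \<le> c1" "m / 2 + e * m / 2 \<le> c1" "\<tau> * k / 2 \<le> c1"
    by (auto simp: c1_def le_max_iff_disj)
  have "c1 > 0" using pos by (intro less_le_trans[OF _ c1(3)]) simp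
  define c2 where "c2 = min (e * l / 2) (min (d / 2) (\<gamma> * l * k / 2))"
  have c2: "c2 \<le> e * l / 2" "c2 \<le> d / 2" "c2 \<le> \<gamma> * l * k / 2" by (auto simp: c2_def)
  have "c2 > 0" using pos e assms by (auto simp: c2_def)
  define S where "S t = (\<theta> t)\<^sup>2 + (\<omega> t)\<^sup>2 + (p t)\<^sup>2" for t
  have upper: "W t \<le> c1 * S t" for t
  proof -
    have "0 \<le> e * m / 2 * (\<omega> t - \<theta> t)\<^sup>2" using e pos by simp
    then have "W t \<le> (l / 2 + e * m / 2 + e * d / 2) * (\<theta> t)\<^sup>2 + (m / 2 + e * m / 2) * (\<omega> t)\<^sup>2
        + \<tau> * k / 2 * (p t)\<^sup>2"
      unfolding W_def by (simp add: power2_eq_square algebra_simps)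
    also have "\<dots> \<le> c1 * (\<theta> t)\<^sup>2 + c1 * (\<omega> t)\<^sup>2 + c1 * (p t)\<^sup>2"
      by (intro add_mono mult_right_mono c1) auto
    finally show ?thesis by (simp add: S_def algebra_simps)
  qed
  have "W' t \<le> - c2 * S t" for t
  proof -
    have "0 \<le> e / (2 * l) * (l * \<theta> t - p t)\<^sup>2" using e assms by simp
    also have "\<dots> = e * l / 2 * (\<theta> t)\<^sup>2 - e * \<theta> t * p t + e / (2 * l) * (p t)\<^sup>2"
      using assms by (simp add: field_simps power2_eq_square)
    finally have 1: "e * \<theta> t * p t \<le> (e * l * (\<theta> t)\<^sup>2) / 2 + e / (2 * l) * (p t)\<^sup>2" by simp
    have "e / (2 * l) \<le> \<gamma> * l * k / 2" using e(3) assms by (simp add: field_simps power2_eq_square)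
    then have "e / (2 * l) * (p t)\<^sup>2 \<le> \<gamma> * l * k / 2 * (p t)\<^sup>2" by (intro mult_right_mono) auto
    then have 2: "e / (2 * l) * (p t)\<^sup>2 \<le> (\<gamma> * l * k * (p t)\<^sup>2) / 2" by simp
    have "(e * m) * (\<omega> t)\<^sup>2 \<le> (d / 2) * (\<omega> t)\<^sup>2" by (intro mult_right_mono e) auto
    then have 3: "(e * m) * (\<omega> t)\<^sup>2 \<le> (d * (\<omega> t)\<^sup>2) / 2" by simp
    have "W' t \<le> - ((e * l * (\<theta> t)\<^sup>2) / 2 + (d * (\<omega> t)\<^sup>2) / 2 + (\<gamma> * l * k * (p t)\<^sup>2) / 2)"
      using 1 2 3 unfolding W'_def left_diff_distrib minus_diff_eq by linarith
    then have "W' t \<le> - (e * l / 2 * (\<theta> t)\<^sup>2 + d / 2 * (\<omega> t)\<^sup>2 + \<gamma> * l * k / 2 * (p t)\<^sup>2)" by simp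
    also have "\<dots> \<le> - (c2 * (\<theta> t)\<^sup>2 + c2 * (\<omega> t)\<^sup>2 + c2 * (p t)\<^sup>2)"
      by (intro le_imp_neg_le add_mono mult_right_mono c2) auto
    finally show ?thesis by (simp add: S_def algebra_simps)
  qed
  moreover have "c2 / c1 * W t \<le> c2 * S t" for t
    using upper[of t] \<open>c1 > 0\<close> \<open>c2 > 0\<close> by (simp add: field_simps)
  ultimately have le: "W' t \<le> - (c2 / c1) * W t" for t
    using order_trans[of "W' t" "- c2 * S t" "- (c2 / c1 * W t)"] by simp
  have parts: "0 \<le> l / 2 * (\<theta> t)\<^sup>2" "0 \<le> m / 4 * (\<omega> t)\<^sup>2" "0 \<le> \<tau> * k / 2 * (p t)\<^sup>2" for t
    using pos assms by auto
  have low: "l / 2 * (\<theta> t)\<^sup>2 \<le> W t" "m / 4 * (\<omega> t)\<^sup>2 \<le> W t" "\<tau> * k / 2 * (p t)\<^sup>2 \<le> W t" "0 \<le> W t" for t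
    using lower[of t] parts[of t] by linarith+
  have W0: "(W \<longlongrightarrow> 0) at_top"
    by (rule lyapunov_decay[OF dW le low(4)]) (use \<open>c1 > 0\<close> \<open>c2 > 0\<close> in simp)
  show "(\<theta> \<longlongrightarrow> 0) at_top" "(\<omega> \<longlongrightarrow> 0) at_top" "(p \<longlongrightarrow> 0) at_top"
    by (rule tendsto_0_of_square_le[OF W0 low(1)] tendsto_0_of_square_le[OF W0 low(2)]
        tendsto_0_of_square_le[OF W0 low(3)]; use pos assms in simp)+
qed

text \<open>For \<open>l = 0\<close> the pair \<open>\<omega>\<close>, \<open>p\<close> evolves
  independently of \<open>\<theta>\<close>, so a Lyapunov function of these two alone
  suffices.\<close>

lemma decay_zero:
  assumes "l = 0"
  shows "(\<omega> \<longlongrightarrow> 0) at_top" "(p \<longlongrightarrow> 0) at_top"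
proof -
  define s where "s = \<tau> * k"
  have s: "s > 0" using pos by (simp add: s_def)
  \<comment> \<open>The first bound pays, out of half the damping of \<open>\<omega>\<close>, for
    the cross term's own contribution \<open>e * m\<close> and for completing the square in
    \<open>e * d * s * \<omega> t * p t\<close>. The second makes \<open>W\<close> positive
    definite; the summand 1 in it also forces \<open>e\<close> below 1.\<close>
  define e where "e = min (d / (2 * (m + s * d\<^sup>2 / 2))) (1 / (4 * (1 + m * s)))"
  have ms: "m + s * d\<^sup>2 / 2 > 0" "1 + m * s > 0" using pos s by (simp_all add: add_pos_nonneg add_pos_pos)
  have e: "e > 0" "e * (m + s * d\<^sup>2 / 2) \<le> d / 2" "e * (e * (m * s)) \<le> 1 / 4"
  proof -
    show "e > 0" using pos ms by (auto simp: e_def)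
    have "e \<le> d / (2 * (m + s * d\<^sup>2 / 2))" unfolding e_def by (rule min.cobounded1)
    then show "e * (m + s * d\<^sup>2 / 2) \<le> d / 2" using ms(1) by (simp add: field_simps)
    have e2: "e \<le> 1 / (4 * (1 + m * s))" unfolding e_def by (rule min.cobounded2)
    then have "e * (1 + m * s) \<le> 1 / 4" using ms(2) by (simp add: field_simps)
    moreover have "e * (m * s) \<le> e * (1 + m * s)" using \<open>e > 0\<close> by simp
    moreover have "e \<le> 1"
    proof (rule order_trans[OF e2])
      have "0 < m * s" using pos s by simp
      then show "1 / (4 * (1 + m * s)) \<le> 1" by (simp add: divide_le_eq_1)
    qed
    moreover have "0 \<le> e * (m * s)" using \<open>e > 0\<close> pos s by simp
    ultimately show "e * (e * (m * s)) \<le> 1 / 4"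
      using mult_left_le_one_le[of "e * (m * s)" e] \<open>e > 0\<close> by linarith
  qed
  \<comment> \<open>Here the energy does not damp \<open>p\<close>, hence a cross term \<open>\<omega> p\<close> instead.\<close>
  define W where "W t = m / 2 * (\<omega> t)\<^sup>2 + s / 2 * (p t)\<^sup>2 - e * m * s * \<omega> t * p t" for t
  define W' where "W' t = - (d - e * m) * (\<omega> t)\<^sup>2 - e * s * (p t)\<^sup>2 + e * d * s * \<omega> t * p t" for t
  have dW: "(W has_real_derivative W' t) (at t)" for t
  proof -
    have "(W has_real_derivative \<omega> t * (m * \<omega>' t) + p t * (\<tau> * k * p' t)
        - e * (s * p t * (m * \<omega>' t) + m * \<omega> t * (\<tau> * k * p' t))) (at t)"
      unfolding W_def
      by (rule derivative_eq_intros d\<omega>' dp' refl)+ (simp add: s_def algebra_simps)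
    then show ?thesis
      unfolding m_\<omega>' \<tau>_k_p' using assms by (simp add: W'_def algebra_simps power2_eq_square)
  qed
  have lower: "W t \<ge> m / 4 * (\<omega> t)\<^sup>2 + s / 4 * (p t)\<^sup>2" for t
  proof -
    have "0 \<le> m / 4 * (\<omega> t - 2 * e * s * p t)\<^sup>2" using pos by simp
    moreover have "s * (e * (e * (m * s))) * (p t)\<^sup>2 \<le> s * (1 / 4) * (p t)\<^sup>2"
      using e s by (intro mult_right_mono mult_left_mono) auto
    ultimately show ?thesis unfolding W_def by (simp add: power2_eq_square algebra_simps)
  qed
  define c1 where "c1 = max (m / 2 + e * m * s / 2) (s / 2 + e * m * s / 2)"
  have c1: "m / 2 + e * m * s / 2 \<le> c1" "s / 2 + e * m * s / 2 \<le> c1" by (auto simp: c1_def)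
  have "c1 > 0" using pos s e(1) by (intro less_le_trans[OF _ c1(1)]) (simp add: add_pos_pos)
  define c2 where "c2 = min (d / 2) (e * s / 2)"
  have c2: "c2 \<le> d / 2" "c2 \<le> e * s / 2" by (auto simp: c2_def)
  have "c2 > 0" using pos e s by (auto simp: c2_def)
  define S where "S t = (\<omega> t)\<^sup>2 + (p t)\<^sup>2" for t
  have upper: "W t \<le> c1 * S t" for t
  proof -
    have "0 \<le> e * m * s / 2 * (\<omega> t + p t)\<^sup>2" using e pos s by simp
    then have "W t \<le> (m / 2 + e * m * s / 2) * (\<omega> t)\<^sup>2 + (s / 2 + e * m * s / 2) * (p t)\<^sup>2"
      unfolding W_def by (simp add: power2_eq_square algebra_simps)
    also have "\<dots> \<le> c1 * (\<omega> t)\<^sup>2 + c1 * (p t)\<^sup>2"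
      by (intro add_mono mult_right_mono c1) auto
    finally show ?thesis by (simp add: S_def algebra_simps)
  qed
  have "W' t \<le> - c2 * S t" for t
  proof -
    have 1: "0 \<le> e * s / 2 * (d * \<omega> t - p t)\<^sup>2" using e s by simp
    have 2: "(e * (m + s * d\<^sup>2 / 2)) * (\<omega> t)\<^sup>2 \<le> (d / 2) * (\<omega> t)\<^sup>2" by (intro mult_right_mono e) auto
    have "W' t \<le> - (d / 2 * (\<omega> t)\<^sup>2 + e * s / 2 * (p t)\<^sup>2)"
      using 1 2 unfolding W'_def by (simp add: algebra_simps power2_eq_square)
    also have "\<dots> \<le> - (c2 * (\<omega> t)\<^sup>2 + c2 * (p t)\<^sup>2)"
      by (intro le_imp_neg_le add_mono mult_right_mono c2) auto
    finally show ?thesis by (simp add: S_def algebra_simps)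
  qed
  moreover have "c2 / c1 * W t \<le> c2 * S t" for t
    using upper[of t] \<open>c1 > 0\<close> \<open>c2 > 0\<close> by (simp add: field_simps)
  ultimately have le: "W' t \<le> - (c2 / c1) * W t" for t
    using order_trans[of "W' t" "- c2 * S t" "- (c2 / c1 * W t)"] by simp
  have parts: "0 \<le> m / 4 * (\<omega> t)\<^sup>2" "0 \<le> s / 4 * (p t)\<^sup>2" for t
    using pos s by auto
  have low: "m / 4 * (\<omega> t)\<^sup>2 \<le> W t" "s / 4 * (p t)\<^sup>2 \<le> W t" "0 \<le> W t" for t
    using lower[of t] parts[of t] by linarith+
  have W0: "(W \<longlongrightarrow> 0) at_top"
    by (rule lyapunov_decay[OF dW le low(3)]) (use \<open>c1 > 0\<close> \<open>c2 > 0\<close> in simp)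
  show "(\<omega> \<longlongrightarrow> 0) at_top" "(p \<longlongrightarrow> 0) at_top"
    by (rule tendsto_0_of_square_le[OF W0 low(1)] tendsto_0_of_square_le[OF W0 low(2)];
        use pos s in simp)+
qed

text \<open>The denominator of the energy formula. Once the other coefficients of the Gramian form
  are eliminated, matching the \<open>(p t)\<^sup>2\<close> terms reads \<open>f * R = k\<close>,
  which fixes the scale of the form.\<close>

definition R where
  "R = m * k * \<gamma>\<^sup>2 / \<tau> * l\<^sup>2 + (m * \<gamma> / (d * \<tau>) + k * d * \<gamma> + k * \<tau>) * l + 1"

lemma R_pos: "R > 0"
  using pos l_nonneg unfolding R_def by (intro add_nonneg_pos add_nonneg_nonneg mult_nonneg_nonneg) auto

text \<open>An impulse only kicks the frequency, so the response starts with zero angle and zero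
  \<open>p\<close>, and the initial value of the Gramian form reduces to its \<open>\<omega>\<close>
  square.\<close>

lemma output_energy:
  assumes "\<theta> 0 = 0" "p 0 = 0"
  shows "(\<integral>\<^sup>+ t\<in>{0..}. ennreal (k * (p t)\<^sup>2) \<partial>lborel) = ennreal (m\<^sup>2 * (\<omega> 0)\<^sup>2 / (2 * \<tau> * d * R))"
proof -
  \<comment> \<open>The coefficients solve \<open>V' = - k p\<^sup>2\<close> with \<open>V\<close> quadratic and \<open>V'\<close> free of all other
    monomials. For \<open>l = 0\<close> the coefficient \<open>q\<close> is not determined, and \<open>q = 0\<close> removes \<open>\<theta>\<close> from \<open>V\<close>.\<close>
  define e where "e = m / (d * \<tau> * R)"
  define q where "q = (if l = 0 then 0 else e * d * \<tau> / (m * \<gamma>))"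
  define f where "f = e * d * \<tau> * k / m"
  have mf: "e * d * \<tau> * k = f * m" using pos by (simp add: f_def)
  define h where "h = q * \<tau> * k + e + d * f + e * d * \<gamma> * l * k"
  \<comment> \<open>There is no product of \<open>\<theta>\<close> and \<open>\<omega>\<close>: for
    \<open>l > 0\<close> nothing could cancel the \<open>\<theta>\<close> square it would put into
    the derivative. The coefficients \<open>q + e * l\<close>, \<open>f\<close>, \<open>q\<close>
    and \<open>h\<close> cancel, in this order, the monomials \<open>\<theta>\<close>
    \<open>\<omega>\<close>, \<open>\<omega>\<close> squared, \<open>\<theta>\<close>
    \<open>p\<close> and \<open>\<omega>\<close> \<open>p\<close>; \<open>e\<close> then normalises
    the \<open>p\<close> square.\<close>
  define V where "V t = (q + e * l) / 2 * (\<theta> t)\<^sup>2 + q * \<tau> * k * \<theta> t * p t + e * m / 2 * (\<omega> t)\<^sup>2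
    - f * m * \<omega> t * p t + h * \<tau> * k / 2 * (p t)\<^sup>2" for t
  have q: "q * (\<gamma> * l * k) = f * l"
    using pos by (simp add: q_def f_def field_simps)
  have f: "f * R = k"
    unfolding f_def e_def using pos R_pos by (simp add: field_simps)
  have R: "R = 1 + \<gamma> * l * (d * k + m / (d * \<tau>)) + l * \<tau> * k + m * k * \<gamma>\<^sup>2 * l\<^sup>2 / \<tau>"
    using pos by (simp add: R_def field_simps)
  have h: "f + h * (\<gamma> * l * k) = k"
  proof -
    \<comment> \<open>Writing \<open>e\<close> through \<open>f\<close> turns \<open>f\<close> into
      a common factor whose cofactor is exactly \<open>R - 1\<close>.\<close>
    have e: "e = f * (m / (d * \<tau> * k))" using pos by (simp add: f_def)
    have "h * (\<gamma> * l * k) = q * (\<gamma> * l * k) * \<tau> * k + (e + d * f + e * d * \<gamma> * l * k) * (\<gamma> * l * k)"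
      unfolding h_def by (simp add: algebra_simps)
    also have "\<dots> = f * (l * \<tau> * k + (m / (d * \<tau> * k) + d + m / (d * \<tau> * k) * d * \<gamma> * l * k) * (\<gamma> * l * k))"
      unfolding q by (subst (1 2) e) (simp add: algebra_simps)
    also have "\<dots> = f * (R - 1)"
      unfolding R using pos by (simp add: field_simps power2_eq_square)
    finally show ?thesis using f by (simp add: algebra_simps)
  qed
  have dV: "((\<lambda>t. - V t) has_real_derivative k * (p t)\<^sup>2) (at t)" for t
  proof -
    \<comment> \<open>Exposes the factor \<open>\<tau> * k * p' t\<close>, for which
      \<open>p'\<close> can be eliminated without division.\<close>
    have fm: "e * d * \<omega> t * (\<tau> * k * p' t) = f * m * \<omega> t * p' t"
      unfolding mf[symmetric] by simp
    have "((\<lambda>t. - V t) has_real_derivative - ((q + e * l) * \<theta> t * \<omega> t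
        + q * \<tau> * k * \<omega> t * p t + q * \<theta> t * (\<tau> * k * p' t) + e * \<omega> t * (m * \<omega>' t)
        - f * p t * (m * \<omega>' t) - e * d * \<omega> t * (\<tau> * k * p' t) + h * p t * (\<tau> * k * p' t))) (at t)"
      unfolding V_def
      by (rule derivative_eq_intros d\<theta> d\<omega>' dp' refl)+
(simp only: fm, simp add: algebra_simps add_divide_distrib)
    also have "- ((q + e * l) * \<theta> t * \<omega> t
        + q * \<tau> * k * \<omega> t * p t + q * \<theta> t * (\<tau> * k * p' t) + e * \<omega> t * (m * \<omega>' t)
        - f * p t * (m * \<omega>' t) - e * d * \<omega> t * (\<tau> * k * p' t) + h * p t * (\<tau> * k * p' t))
      = (q * (\<gamma> * l * k) - f * l) * \<theta> t * p t
        + (h - (q * \<tau> * k + e + d * f + e * d * \<gamma> * l * k)) * \<omega> t * p t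
        + (f + h * (\<gamma> * l * k)) * (p t)\<^sup>2"
      unfolding m_\<omega>' \<tau>_k_p' by (simp add: algebra_simps power2_eq_square)
    also have "\<dots> = k * (p t)\<^sup>2" unfolding q h by (simp add: h_def)
    finally show ?thesis .
  qed
  have "(V \<longlongrightarrow> 0) at_top"
  proof (cases "l = 0")
    case True
    have "V = (\<lambda>t. e * m / 2 * (\<omega> t)\<^sup>2 - f * m * \<omega> t * p t + h * \<tau> * k / 2 * (p t)\<^sup>2)"
      using True by (simp add: V_def q_def fun_eq_iff)
    moreover have "(\<dots> \<longlongrightarrow> e * m / 2 * 0\<^sup>2 - f * m * 0 * 0 + h * \<tau> * k / 2 * 0\<^sup>2) at_top"
      by (intro tendsto_intros decay_zero True)
    ultimately show ?thesis by simp
  next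
    case False
    then have "l > 0" using l_nonneg by simp
    have "(V \<longlongrightarrow> (q + e * l) / 2 * 0\<^sup>2 + q * \<tau> * k * 0 * 0 + e * m / 2 * 0\<^sup>2
       - f * m * 0 * 0 + h * \<tau> * k / 2 * 0\<^sup>2) at_top"
      unfolding V_def by (intro tendsto_intros decay_pos \<open>l > 0\<close>)
    then show ?thesis by simp
  qed
  then have lim: "((\<lambda>t. - V t) \<longlongrightarrow> 0) at_top" using tendsto_minus by fastforce
  have "continuous_on UNIV p" using dp by (intro continuous_at_imp_continuous_on) (auto intro: DERIV_isCont)
  then have "(\<lambda>t. k * (p t)\<^sup>2) \<in> borel_measurable borel"
    by (intro borel_measurable_continuous_onI continuous_intros)
  from nn_integral_FTC_atLeast[OF this dV _ lim, of 0]
  have "(\<integral>\<^sup>+ t\<in>{0..}. ennreal (k * (p t)\<^sup>2) \<partial>lborel) = ennreal (V 0)"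
    using pos by simp
  also have "V 0 = m\<^sup>2 * (\<omega> 0)\<^sup>2 / (2 * \<tau> * d * R)"
    using assms by (simp add: V_def e_def power2_eq_square field_simps)
  finally show ?thesis .
qed

end

section \<open>The closed-loop system\<close>

lemma mat_mult_vector: "mat c *v x = c *\<^sub>R (x :: real^'n)"
  by (simp add: vec_eq_iff matrix_vector_mult_def mat_def if_distrib[of "\<lambda>y. y * _"] cong: if_cong)

lemma mat_mult_mat: "mat a ** mat b = (mat (a * b) :: real^'n^'n)"
  by (simp add: vec_eq_iff matrix_matrix_mult_def mat_def if_distrib[of "\<lambda>y. y * _"] cong: if_cong)

lemma matrix_inv_mat:
  assumes "a \<noteq> 0"
  shows "matrix_inv (mat a :: real^'n^'n) = mat (1 / a)"
proof -
  let ?A = "mat a :: real^'n^'n"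
  have inv: "?A ** mat (1 / a) = mat 1" using assms by (simp add: mat_mult_mat)
  have "?A ** matrix_inv ?A = mat 1 \<and> matrix_inv ?A ** ?A = mat 1"
    unfolding matrix_inv_def
    by (rule someI[where x = "mat (1 / a)"]) (use assms in \<open>simp add: mat_mult_mat\<close>)
  then show ?thesis by (metis inv matrix_mul_assoc matrix_mul_lid matrix_mul_rid)
qed

text \<open>Uniqueness: v = S x - sqrt k x satisfies (S + sqrt k) v = (S^2 - k) x = 0, and pairing
  this with v makes two nonnegative terms add up to 0.\<close>

lemma psd_sqrt_mat:
  assumes k: "k > 0"
  shows "psd_sqrt (mat k :: real^'n^'n) = mat (sqrt k)"
  unfolding psd_sqrt_def
proof (rule the_equality)
  show "transpose (mat (sqrt k)) = (mat (sqrt k) :: real^'n^'n) \<and>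
      (\<forall>x. 0 \<le> x \<bullet> ((mat (sqrt k) :: real^'n^'n) *v x)) \<and>
      mat (sqrt k) ** mat (sqrt k) = (mat k :: real^'n^'n)"
    using k by (simp add: mat_mult_mat mat_mult_vector)
next
  fix S :: "real^'n^'n"
  assume S: "transpose S = S \<and> (\<forall>x. 0 \<le> x \<bullet> (S *v x)) \<and> S ** S = mat k"
  have "S *v x = mat (sqrt k) *v x" for x
  proof -
    define v where "v = S *v x - sqrt k *\<^sub>R x"
    have "S *v v + sqrt k *\<^sub>R v = (S ** S) *v x - (sqrt k * sqrt k) *\<^sub>R x"
      by (simp add: v_def matrix_vector_mult_diff_distrib matrix_vector_mul_assoc[symmetric]
          algebra_simps matrix_vector_mult_scaleR)
    also have "\<dots> = 0" using S k by (simp add: mat_mult_vector)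
    finally have "v \<bullet> (S *v v) + sqrt k * (v \<bullet> v) = 0"
      by (metis inner_add_right inner_scaleR_right inner_zero_right)
    moreover have "0 \<le> v \<bullet> (S *v v)" "0 \<le> sqrt k * (v \<bullet> v)" using S k by simp_all
    ultimately have "sqrt k * (v \<bullet> v) = 0" by linarith
    then show ?thesis using k by (simp add: v_def mat_mult_vector)
  qed
  then show "S = mat (sqrt k)" by (simp add: matrix_eq)
qed

section \<open>Action of the system matrices on packed states\<close>

lemma parts_pack [simp]:
  "theta_part (pack th om p) = th" "omega_part (pack th om p) = om" "p_part (pack th om p) = p"
  by (simp_all add: theta_part_def omega_part_def p_part_def pack_def)

lemma linear_parts: "linear theta_part" "linear omega_part" "linear p_part"
  by (auto intro!: linearI simp: theta_part_def omega_part_def p_part_def vec_eq_iff)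

lemma pack_add: "pack (a + a') (b + b') (c + c') = pack a b c + pack a' b' c'"
  by (auto simp: pack_def vec_eq_iff split: sum.split)

lemma pack_scaleR: "pack (r *\<^sub>R a) (r *\<^sub>R b) (r *\<^sub>R c) = r *\<^sub>R pack a b c"
  by (auto simp: pack_def vec_eq_iff split: sum.split)

lemma linear_pack:
  assumes "linear f" "linear g" "linear h"
  shows "linear (\<lambda>x. pack (f x) (g x) (h x))"
  using assms by (intro linearI) (simp_all add: linear_add linear_cmul pack_add pack_scaleR)

text \<open>The matrix is given as \<open>matrix\<close> of a map, so it acts as that map once the
  map is known to be linear.\<close>

lemma sys_A_mult:
  "sys_A L M D K T Lc *v x = pack
     (omega_part x)
     (matrix_inv M *v (- (L *v theta_part x) - D *v omega_part x + p_part x))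
     (matrix_inv (T ** K) *v (- omega_part x - (Lc ** K) *v p_part x))"
proof -
  have mv: "linear (\<lambda>x. A *v f x)" if "linear f" for A :: "real^'n^'n" and f :: "'n state \<Rightarrow> real^'n"
    using linear_compose[OF that matrix_vector_mul_linear] by (simp add: o_def)
  show ?thesis
    unfolding sys_A_def
    by (intro fun_cong[OF matrix_vector_mul(2)] linear_pack mv linear_parts
        linear_compose_add linear_compose_sub linear_compose_neg)
qed

lemma sys_B_mult: "sys_B M B1 *v \<eta> = pack 0 (matrix_inv M *v (B1 *v \<eta>)) 0"
proof -
  have "linear (\<lambda>\<eta>. matrix_inv M *v (B1 *v \<eta>))"
    by (simp add: matrix_vector_mul_assoc)
  then show ?thesis
    unfolding sys_B_def
    by (intro fun_cong[OF matrix_vector_mul(2)] linear_pack linear_zero)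
qed

lemma sys_C_mult: "sys_C K *v x = psd_sqrt K *v p_part x"
proof -
  have "linear (\<lambda>x. psd_sqrt K *v p_part x)"
    using linear_compose[OF linear_parts(3) matrix_vector_mul_linear] by (simp add: o_def)
  then show ?thesis
    unfolding sys_C_def by (intro fun_cong[OF matrix_vector_mul(2)])
qed

text \<open>Since \<open>L\<close> is symmetric, \<open>q\<close> is also a left eigenvector; all
  other parameter matrices are scalar, so projecting the state equation onto \<open>q\<close> closes
  up.\<close>

lemma swing_mode_of_eigenvector:
  fixes L :: "real^'n^'n" and q :: "real^'n" and x0 :: "'n state"
  assumes pos: "m > 0" "d > 0" "k > 0" "\<tau> > 0" "\<gamma> > 0" "l \<ge> 0"
    and L: "transpose L = L" and q: "L *v q = l *\<^sub>R q"
  defines "A \<equiv> sys_A L (mat m) (mat d) (mat k) (mat \<tau>) (\<gamma> *\<^sub>R L)"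
  shows "swing_mode m d k \<tau> \<gamma> l (\<lambda>t. q \<bullet> theta_part (matexp (t *\<^sub>R A) *v x0))
    (\<lambda>t. q \<bullet> omega_part (matexp (t *\<^sub>R A) *v x0)) (\<lambda>t. q \<bullet> p_part (matexp (t *\<^sub>R A) *v x0))"
proof -
  have qL: "q \<bullet> (L *v v) = l * (q \<bullet> v)" for v
    by (metis L dot_lmul_matrix inner_scaleR_left q vector_transpose_matrix)
  have Lc: "((\<gamma> *\<^sub>R L) ** mat k) *v v = (\<gamma> * k) *\<^sub>R (L *v v)" for v
    by (simp add: matrix_vector_mul_assoc[symmetric] mat_mult_vector matrix_vector_mult_scaleR
        scaleR_matrix_vector_assoc[symmetric] mult.commute)
  have der: "((\<lambda>t. q \<bullet> f (matexp (t *\<^sub>R A) *v x0)) has_real_derivative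
      q \<bullet> f (A *v (matexp (t *\<^sub>R A) *v x0))) (at t)" if "linear f" for f t
  proof -
    have "bounded_linear (\<lambda>x. q \<bullet> f x)"
      using that by (simp add: bounded_linear_inner_right_comp linear_conv_bounded_linear)
    from bounded_linear.has_vector_derivative[OF this has_vector_derivative_matexp]
    show ?thesis by (simp add: has_real_derivative_iff_has_vector_derivative)
  qed
  show ?thesis
  proof (unfold_locales; (fact pos)?)
    fix t
    let ?x = "matexp (t *\<^sub>R A) *v x0"
    show "((\<lambda>t. q \<bullet> theta_part (matexp (t *\<^sub>R A) *v x0)) has_real_derivative q \<bullet> omega_part ?x) (at t)"
      using der[OF linear_parts(1), of t] by (simp add: A_def sys_A_mult)
    show "((\<lambda>t. q \<bullet> omega_part (matexp (t *\<^sub>R A) *v x0)) has_real_derivative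
        (- l * (q \<bullet> theta_part ?x) - d * (q \<bullet> omega_part ?x) + q \<bullet> p_part ?x) / m) (at t)"
      using der[OF linear_parts(2), of t] pos
      by (simp add: A_def sys_A_mult matrix_inv_mat mat_mult_vector qL inner_add_right inner_diff_right)
    show "((\<lambda>t. q \<bullet> p_part (matexp (t *\<^sub>R A) *v x0)) has_real_derivative
        (- (q \<bullet> omega_part ?x) - \<gamma> * l * k * (q \<bullet> p_part ?x)) / (\<tau> * k)) (at t)"
      using der[OF linear_parts(3), of t] pos
      by (simp add: A_def sys_A_mult mat_mult_mat matrix_inv_mat mat_mult_vector Lc qL
          inner_diff_right mult_ac)
  qed
qed

text \<open>In the double sum from the trace, \<open>j\<close> names the direction of the impulse
  and \<open>i\<close> the observed mode. By orthonormality mode \<open>i\<close> starts with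
  frequency b / m if i = j and with 0 otherwise, so only the diagonal carries energy.\<close>

lemma sys_h2_sq_eigenbasis:
  fixes L :: "real^'n^'n" and q :: "'n \<Rightarrow> real^'n"
  assumes pos: "m > 0" "d > 0" "k > 0" "\<tau> > 0" "\<gamma> > 0"
    and L: "transpose L = L"
    and q: "\<And>i j. q i \<bullet> q j = (if i = j then 1 else 0)"
    and \<mu>: "\<And>i. L *v q i = \<mu> i *\<^sub>R q i" "\<And>i. 0 \<le> \<mu> i"
  shows "sys_h2_sq L (mat m) (mat d) (mat k) (mat b) (mat \<tau>) (\<gamma> *\<^sub>R L) =
    ennreal (b\<^sup>2 / (2 * \<tau>) * (1 / d) *
      (\<Sum>i\<in>UNIV. 1 / (m * k * \<gamma>\<^sup>2 / \<tau> * (\<mu> i)\<^sup>2 + (m * \<gamma> / (d * \<tau>) + k * d * \<gamma> + k * \<tau>) * \<mu> i + 1)))"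
proof -
  define A where "A = sys_A L (mat m) (mat d) (mat k) (mat \<tau>) (\<gamma> *\<^sub>R L)"
  define B :: "real^'n^('n + 'n + 'n)" where "B = sys_B (mat m) (mat b)"
  define C :: "real^('n + 'n + 'n)^'n" where "C = sys_C (mat k)"
  define r where "r i = m * k * \<gamma>\<^sup>2 / \<tau> * (\<mu> i)\<^sup>2 + (m * \<gamma> / (d * \<tau>) + k * d * \<gamma> + k * \<tau>) * \<mu> i + 1" for i
  define g where "g i j t = k * (q i \<bullet> p_part (matexp (t *\<^sub>R A) *v (B *v q j)))\<^sup>2" for i j t
  have g_nonneg: "0 \<le> g i j t" for i j t using pos by (simp add: g_def)
  have B0: "B *v v = pack 0 ((b / m) *\<^sub>R v) 0" for v
    using pos by (simp add: B_def sys_B_mult matrix_inv_mat mat_mult_vector)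
  have mode: "swing_mode m d k \<tau> \<gamma> (\<mu> i) (\<lambda>t. q i \<bullet> theta_part (matexp (t *\<^sub>R A) *v x0))
    (\<lambda>t. q i \<bullet> omega_part (matexp (t *\<^sub>R A) *v x0)) (\<lambda>t. q i \<bullet> p_part (matexp (t *\<^sub>R A) *v x0))" for i x0
    unfolding A_def by (rule swing_mode_of_eigenvector[OF pos \<mu>(2) L \<mu>(1)])
  have g_int: "(\<integral>\<^sup>+ t. ennreal (g i j t) * indicator {0..} t \<partial>lborel)
      = ennreal (if i = j then b\<^sup>2 / (2 * \<tau> * d) / r i else 0)" for i j
  proof -
    interpret swing_mode m d k \<tau> \<gamma> "\<mu> i" "\<lambda>t. q i \<bullet> theta_part (matexp (t *\<^sub>R A) *v (B *v q j))"
      "\<lambda>t. q i \<bullet> omega_part (matexp (t *\<^sub>R A) *v (B *v q j))"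
      "\<lambda>t. q i \<bullet> p_part (matexp (t *\<^sub>R A) *v (B *v q j))"
      by (rule mode)
    have "(\<integral>\<^sup>+ t. ennreal (g i j t) * indicator {0..} t \<partial>lborel)
      = ennreal (m\<^sup>2 * (q i \<bullet> omega_part (matexp (0 *\<^sub>R A) *v (B *v q j)))\<^sup>2 / (2 * \<tau> * d * r i))"
      unfolding g_def r_def R_def[symmetric]
      by (rule output_energy) (simp_all add: matexp_0 B0)
    also have "q i \<bullet> omega_part (matexp (0 *\<^sub>R A) *v (B *v q j)) = (if i = j then b / m else 0)"
      by (simp add: matexp_0 B0 q)
    finally show ?thesis using pos by (simp add: field_simps power2_eq_square split: if_splits)
  qed
  have g_meas: "g i j \<in> borel_measurable lborel" for i j
  proof -
    interpret swing_mode m d k \<tau> \<gamma> "\<mu> i" "\<lambda>t. q i \<bullet> theta_part (matexp (t *\<^sub>R A) *v (B *v q j))"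
      "\<lambda>t. q i \<bullet> omega_part (matexp (t *\<^sub>R A) *v (B *v q j))"
      "\<lambda>t. q i \<bullet> p_part (matexp (t *\<^sub>R A) *v (B *v q j))"
      by (rule mode)
    have "continuous_on UNIV (\<lambda>t. q i \<bullet> p_part (matexp (t *\<^sub>R A) *v (B *v q j)))"
      using dp by (intro continuous_at_imp_continuous_on) (auto intro: DERIV_isCont)
    then have "continuous_on UNIV (g i j)"
      unfolding g_def[abs_def]
      by (intro continuous_on_mult continuous_on_const continuous_on_power)
    then show ?thesis by (simp add: borel_measurable_continuous_onI)
  qed
  have tr: "trace (transpose B ** matexp (t *\<^sub>R transpose A) ** transpose C ** C ** matexp (t *\<^sub>R A) ** B)
      = (\<Sum>i\<in>UNIV. \<Sum>j\<in>UNIV. g i j t)" for t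
  proof -
    let ?N = "C ** matexp (t *\<^sub>R A) ** B"
    have "transpose B ** matexp (t *\<^sub>R transpose A) ** transpose C ** C ** matexp (t *\<^sub>R A) ** B
        = transpose ?N ** ?N"
      by (simp add: matrix_transpose_mul transpose_matexp transpose_scalar matrix_mul_assoc)
    then have "trace (transpose B ** matexp (t *\<^sub>R transpose A) ** transpose C ** C ** matexp (t *\<^sub>R A) ** B)
        = (\<Sum>i\<in>UNIV. \<Sum>j\<in>UNIV. (q i \<bullet> (?N *v q j))\<^sup>2)"
      by (simp only: trace_transpose_mult_eigenbasis[OF q])
    moreover have "q i \<bullet> (?N *v q j) = sqrt k * (q i \<bullet> p_part (matexp (t *\<^sub>R A) *v (B *v q j)))" for i j
      using pos by (simp add: C_def matrix_vector_mul_assoc[symmetric] sys_C_mult psd_sqrt_mat mat_mult_vector)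
    ultimately show ?thesis using pos by (simp add: g_def power_mult_distrib)
  qed
  have "sys_h2_sq L (mat m) (mat d) (mat k) (mat b) (mat \<tau>) (\<gamma> *\<^sub>R L)
    = (\<integral>\<^sup>+ t. ennreal (\<Sum>i\<in>UNIV. \<Sum>j\<in>UNIV. g i j t) * indicator {0..} t \<partial>lborel)"
    unfolding sys_h2_sq_def h2_norm_sq_def A_def[symmetric] B_def[symmetric] C_def[symmetric] tr ..
  also have "\<dots> = (\<integral>\<^sup>+ t. (\<Sum>i\<in>UNIV. \<Sum>j\<in>UNIV. ennreal (g i j t) * indicator {0..} t) \<partial>lborel)"
    by (simp add: sum_ennreal[symmetric] g_nonneg sum_nonneg sum_distrib_right del: sum_ennreal)
  also have "\<dots> = (\<Sum>i\<in>UNIV. \<Sum>j\<in>UNIV. \<integral>\<^sup>+ t. ennreal (g i j t) * indicator {0..} t \<partial>lborel)"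
  proof -
    have "(\<lambda>t. ennreal (g i j t) * indicator {0..} t) \<in> borel_measurable lborel" for i j
      using g_meas by measurable
    then show ?thesis by (simp only: nn_integral_sum borel_measurable_sum)
  qed
  also have "\<dots> = (\<Sum>i\<in>UNIV. ennreal (b\<^sup>2 / (2 * \<tau> * d) / r i))"
    unfolding g_int by (simp add: if_distrib[of ennreal] cong: if_cong)
  also have "\<dots> = ennreal (\<Sum>i\<in>UNIV. b\<^sup>2 / (2 * \<tau> * d) / r i)"
  proof (rule sum_ennreal)
    fix i
    have "r i > 0" unfolding r_def using pos \<mu>(2)[of i]
      by (intro add_nonneg_pos add_nonneg_nonneg mult_nonneg_nonneg) auto
    then show "0 \<le> b\<^sup>2 / (2 * \<tau> * d) / r i" using pos by simp
  qed
  also have "(\<Sum>i\<in>UNIV. b\<^sup>2 / (2 * \<tau> * d) / r i) = b\<^sup>2 / (2 * \<tau>) * (1 / d) * (\<Sum>i\<in>UNIV. 1 / r i)"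
    by (simp add: sum_distrib_left)
  finally show ?thesis by (simp only: r_def)
qed

theorem mainTheorem4:
  fixes E :: "'n::finite set set" and w :: "'n set \<Rightarrow> real"
    and L :: "real^'n^'n" and lam :: "nat \<Rightarrow> real"
    and m d k b \<tau> \<gamma> z1 z2 :: real and n :: nat
  assumes "simple_graph E" "graph_connected E" "graph_acyclic E"
    and "\<forall>e\<in>E. 0 < w e"
    and "L = laplacian E w"
    and "n = CARD('n)"
    and "ordered_eigenvalues L lam"
    and "m > 0" "d > 0" "k > 0" "b > 0" "\<tau> > 0" "\<gamma> > 0"
    and "z2 = m * k * \<gamma>^2 / \<tau>"
    and "z1 = m * \<gamma> / (d * \<tau>) + k * d * \<gamma> + k * \<tau>"
  shows "lam 1 = 0 \<and> (\<forall>i\<in>{2..n}. 0 < lam i) \<and>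
    sys_h2_sq L (mat m) (mat d) (mat k) (mat b) (mat \<tau>) (\<gamma> *\<^sub>R L) =
      ennreal (b^2 / (2 * \<tau>) * (1 / d) *
        (\<Sum>i = 1..n. 1 / (z2 * (lam i)^2 + z1 * lam i + 1))) \<and>
    ((\<lambda>m'. sys_h2_sq L (mat m') (mat d) (mat k) (mat b) (mat \<tau>) (\<gamma> *\<^sub>R L)) \<longlongrightarrow>
      ennreal (b^2 / (2 * \<tau>) * (1 / d) *
        (\<Sum>i = 1..n. 1 / (1 + (k * \<tau> + k * d * \<gamma>) * lam i)))) (at_right 0) \<and>
    ((\<lambda>\<gamma>'. sys_h2_sq L (mat m) (mat d) (mat k) (mat b) (mat \<tau>) (\<gamma>' *\<^sub>R L)) \<longlongrightarrow>
      ennreal (b^2 / (2 * \<tau>) * (1 / d))) at_top"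
proof -
  have L: "L = laplacian E w" and sym: "transpose L = L"
    using assms(5) by (simp_all add: transpose_laplacian)
  obtain q :: "'n \<Rightarrow> real^'n" and \<mu> where "\<forall>i j. q i \<bullet> q j = (if i = j then 1 else 0)" "\<forall>i. L *v q i = \<mu> i *\<^sub>R q i"
    using symmetric_matrix_eigenbasis[OF sym] by blast
  then have q: "q i \<bullet> q j = (if i = j then 1 else 0)" and \<mu>: "L *v q i = \<mu> i *\<^sub>R q i" for i j
    by auto
  have det: "det (mat x - L) = (\<Prod>i\<in>UNIV. x - \<mu> i)" for x
    by (rule det_mat_minus_eigenbasis[OF q \<mu>])
  obtain i0 where i0: "\<mu> i0 = 0" "\<And>i. i \<noteq> i0 \<Longrightarrow> 0 < \<mu> i"
    using laplacian_eigenvalues[OF assms(1,4,2) q \<mu>[unfolded L] det[unfolded L]] by blast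
  then have \<mu>_nonneg: "0 \<le> \<mu> i" for i by (cases "i = i0") (auto intro: less_imp_le)
  have lam: "(\<Prod>i = 1..n. x - lam i) = (\<Prod>i\<in>UNIV. x - \<mu> i)" and mono: "mono_on {1..n} lam" for x
    using assms(6,7) det by (auto simp: ordered_eigenvalues_def)
  \<comment> \<open>From here on any symmetric expression in the node-indexed \<open>\<mu>\<close>
    can be restated for the ranked \<open>lam\<close>.\<close>
  have ms: "image_mset lam (mset_set {1..n}) = image_mset \<mu> (mset_set UNIV)"
    by (rule image_mset_eq_of_linear_factors[OF _ _ lam]) simp_all
  have n1: "n \<ge> 1" using assms(6) by (simp add: Suc_leI)
  have sum_eq: "(\<Sum>i\<in>UNIV. f (\<mu> i)) = (\<Sum>i = 1..n. f (lam i))" for f :: "real \<Rightarrow> real"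
  proof -
    have "(\<Sum>i\<in>UNIV. f (\<mu> i)) = sum_mset (image_mset f (image_mset \<mu> (mset_set UNIV)))"
      by (simp add: sum_unfold_sum_mset multiset.map_comp comp_def)
    also have "\<dots> = (\<Sum>i = 1..n. f (lam i))"
      unfolding ms[symmetric] by (simp add: sum_unfold_sum_mset multiset.map_comp comp_def)
    finally show ?thesis .
  qed
  have lam_nonneg: "0 \<le> lam i" if "i \<in> {1..n}" for i
  proof -
    have "lam i \<in># image_mset lam (mset_set {1..n})" using that by simp
    then show ?thesis unfolding ms using \<mu>_nonneg by auto
  qed
  \<comment> \<open>Counting zeros is one such symmetric expression: exactly one
    \<open>lam i\<close> vanishes, and monotonicity together with nonnegativity puts it at rank
    1.\<close>
  have "(\<Sum>i = 1..n. of_bool (lam i = 0)) = (\<Sum>i\<in>UNIV. of_bool (\<mu> i = 0) :: real)"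
    by (rule sum_eq[symmetric])
  also have "\<dots> = (\<Sum>i\<in>UNIV. of_bool (i = i0))"
    by (intro sum.cong) (use i0 in \<open>auto dest!: i0(2)\<close>)
  also have "\<dots> = 1" by simp
  finally have card0: "card {i \<in> {1..n}. lam i = 0} = 1"
    by (simp add: of_bool_def sum.If_cases Int_def)
  then obtain j where j: "{i \<in> {1..n}. lam i = 0} = {j}" by (auto simp: card_1_singleton_iff)
  then have "j \<in> {1..n}" "lam j = 0" by auto
  have "lam 1 \<le> lam j" using mono \<open>j \<in> {1..n}\<close> by (auto simp: mono_on_def)
  then have lam1: "lam 1 = 0" using \<open>lam j = 0\<close> lam_nonneg[of 1] n1 by simp
  then have "1 \<in> {i \<in> {1..n}. lam i = 0}" using n1 by simp
  then have "1 = j" unfolding j by simp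
  have lam_pos: "0 < lam i" if "i \<in> {2..n}" for i
  proof -
    have "lam i \<noteq> 0"
    proof
      assume "lam i = 0"
      then have "i \<in> {i \<in> {1..n}. lam i = 0}" using that by simp
      then show False using that unfolding j \<open>1 = j\<close>[symmetric] by simp
    qed
    then show ?thesis using lam_nonneg[of i] that by simp
  qed
  let ?F = "\<lambda>m \<gamma>. b\<^sup>2 / (2 * \<tau>) * (1 / d) * (\<Sum>i = 1..n. 1 / (m * k * \<gamma>\<^sup>2 / \<tau> * (lam i)\<^sup>2
    + (m * \<gamma> / (d * \<tau>) + k * d * \<gamma> + k * \<tau>) * lam i + 1))"
  \<comment> \<open>Kept general in the inertia and the gain, because each limit varies one of
    them.\<close>
  have h2: "sys_h2_sq L (mat m') (mat d) (mat k) (mat b) (mat \<tau>) (\<gamma>' *\<^sub>R L) = ennreal (?F m' \<gamma>')"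
    if "m' > 0" "\<gamma>' > 0" for m' \<gamma>'
    using sys_h2_sq_eigenbasis[OF that(1) assms(9,10,12) that(2) sym q \<mu> \<mu>_nonneg]
      sum_eq[of "\<lambda>l. 1 / (m' * k * \<gamma>'\<^sup>2 / \<tau> * l\<^sup>2 + (m' * \<gamma>' / (d * \<tau>) + k * d * \<gamma>' + k * \<tau>) * l + 1)"]
    by simp
  \<comment> \<open>\<open>?F\<close> is continuous at inertia 0, since there every denominator is
    at least 1.\<close>
  have lim_m: "((\<lambda>m'. ?F m' \<gamma>) \<longlongrightarrow> ?F 0 \<gamma>) (at_right 0)"
  proof -
    have "0 \<noteq> 0 * k * \<gamma>\<^sup>2 / \<tau> * (lam i)\<^sup>2 + (0 * \<gamma> / (d * \<tau>) + k * d * \<gamma> + k * \<tau>) * lam i + 1"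
      if "i \<in> {1..n}" for i
    proof -
      have "0 \<le> (k * d * \<gamma> + k * \<tau>) * lam i"
        using lam_nonneg[OF that] assms(8-13) by (intro mult_nonneg_nonneg) auto
      then show ?thesis by simp
    qed
    then show ?thesis by (intro tendsto_intros) (use assms(8-13) in auto)
  qed
  \<comment> \<open>The limit is written as a sum of indicators so that it can be taken term by
    term: the zero mode contributes 1 for every gain, all other terms vanish.\<close>
  have lim_\<gamma>: "((\<lambda>\<gamma>'. ?F m \<gamma>') \<longlongrightarrow> b\<^sup>2 / (2 * \<tau>) * (1 / d) * (\<Sum>i = 1..n. of_bool (i = 1))) at_top"
  proof (intro tendsto_mult tendsto_const tendsto_sum)
    fix i assume i: "i \<in> {1..n}"
    show "((\<lambda>\<gamma>'. 1 / (m * k * \<gamma>'\<^sup>2 / \<tau> * (lam i)\<^sup>2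
      + (m * \<gamma>' / (d * \<tau>) + k * d * \<gamma>' + k * \<tau>) * lam i + 1)) \<longlongrightarrow> of_bool (i = 1)) at_top"
    proof (cases "i = 1")
      case True
      then show ?thesis using lam1 by simp
    next
      case False
      then have l: "lam i > 0" using i by (intro lam_pos) auto
      have c: "k * d * lam i > 0" using l assms(8-13) by simp
      \<comment> \<open>The single linear term \<open>k * d * lam i * \<gamma>'\<close> already
        forces divergence; the remaining terms are nonnegative for nonnegative gain.\<close>
      have "filterlim (\<lambda>\<gamma>'. m * k * \<gamma>'\<^sup>2 / \<tau> * (lam i)\<^sup>2
          + (m * \<gamma>' / (d * \<tau>) + k * d * \<gamma>' + k * \<tau>) * lam i + 1) at_top at_top"
      proof (rule filterlim_at_top_mono)
        show "filterlim (\<lambda>\<gamma>'. k * d * lam i * \<gamma>') at_top at_top"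
          by (intro filterlim_tendsto_pos_mult_at_top[OF tendsto_const c] filterlim_ident)
        show "\<forall>\<^sub>F \<gamma>' in at_top. k * d * lam i * \<gamma>' \<le> m * k * \<gamma>'\<^sup>2 / \<tau> * (lam i)\<^sup>2
          + (m * \<gamma>' / (d * \<tau>) + k * d * \<gamma>' + k * \<tau>) * lam i + 1"
          using eventually_ge_at_top[of 0]
        proof eventually_elim
          case (elim x)
          have "0 \<le> m * k * x\<^sup>2 / \<tau> * (lam i)\<^sup>2" "0 \<le> m * x / (d * \<tau>) * lam i" "0 \<le> k * \<tau> * lam i"
            using l assms(8-13) elim by simp_all
          then show ?case by (simp add: algebra_simps)
        qed
      qed
      then have "((\<lambda>\<gamma>'. 1 / (m * k * \<gamma>'\<^sup>2 / \<tau> * (lam i)\<^sup>2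
          + (m * \<gamma>' / (d * \<tau>) + k * d * \<gamma>' + k * \<tau>) * lam i + 1)) \<longlongrightarrow> 0) at_top"
        by (rule tendsto_divide_0[OF tendsto_const filterlim_at_top_imp_at_infinity])
      then show ?thesis using False by simp
    qed
  qed
  have lim_m': "((\<lambda>m'. sys_h2_sq L (mat m') (mat d) (mat k) (mat b) (mat \<tau>) (\<gamma> *\<^sub>R L)) \<longlongrightarrow>
      ennreal (?F 0 \<gamma>)) (at_right 0)"
    \<comment> \<open>The closed formula is available only for positive inertia, which holds
      eventually along \<open>at_right 0\<close>; the limit is transferred by eventual
      equality.\<close>
    using tendsto_ennrealI[OF lim_m]
    by (rule Lim_transform_eventually)
      (use assms(13) in \<open>auto simp: h2 intro: eventually_mono[OF eventually_at_right_less]\<close>)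
  have lim_\<gamma>': "((\<lambda>\<gamma>'. sys_h2_sq L (mat m) (mat d) (mat k) (mat b) (mat \<tau>) (\<gamma>' *\<^sub>R L)) \<longlongrightarrow>
      ennreal (b\<^sup>2 / (2 * \<tau>) * (1 / d) * (\<Sum>i = 1..n. of_bool (i = 1)))) at_top"
    using tendsto_ennrealI[OF lim_\<gamma>]
    by (rule Lim_transform_eventually)
      (use assms(8) in \<open>auto simp: h2 intro: eventually_mono[OF eventually_gt_at_top[of 0]]\<close>)
  have sum1: "(\<Sum>i = 1..n. of_bool (i = 1)) = (1 :: real)"
    using n1 by simp
  have F0: "?F 0 \<gamma> = b\<^sup>2 / (2 * \<tau>) * (1 / d) * (\<Sum>i = 1..n. 1 / (1 + (k * \<tau> + k * d * \<gamma>) * lam i))"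
    by (simp add: add.commute)
  show ?thesis
    using lam1 lam_pos h2[OF assms(8,13)] lim_m'[unfolded F0] lim_\<gamma>'[unfolded sum1 mult_1_right]
    unfolding assms(14,15) by blast
qed

end
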